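(* Let $p$ be a prime with $p\equiv 1\pmod 8$ and let $G=\mathrm{PSL}(2,p)$. If $m(G)=3$, then $G$ fails the replacement property.
   Context: A generating sequence $(g_1,\dots,g_k)$ of a finite group $G$ is irredundant if, for every $j$, removing $g_j$ leaves a sequence that does not generate $G$; $m(G)$ is the maximum length of an irredundant generating sequence of $G$. $G$ satisfies the replacement property for the generating sequence $s=(g_1,\dots,g_k)$ if for every non-identity $g\in G$ there exists an $i$ such that $(g_1,\dots,g_{i-1},g,g_{i+1},\dots,g_k)$ generates $G$. $G$ satisfies the replacement property if it satisfies it for all irredundant generating sequences of length $m(G)$; otherwise $G$ fails the replacement property. *)

theory Defs
  imports "HOL-Algebra.Generated_Groups" "HOL-Number_Theory.Residues"
begin

section \<open>The groups SL(2,R) and PSL(2,R)\<close>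

text \<open>A \<open>2 \<times> 2\<close> matrix over \<open>R\<close> is the tuple \<open>(a, b, c, d)\<close> of its entries, read row by row.\<close>

type_synonym 'a mat2 = "'a \<times> 'a \<times> 'a \<times> 'a"

definition det2 :: "('a, 'm) ring_scheme \<Rightarrow> 'a mat2 \<Rightarrow> 'a" where
  "det2 R = (\<lambda>(a, b, c, d). a \<otimes>\<^bsub>R\<^esub> d \<ominus>\<^bsub>R\<^esub> b \<otimes>\<^bsub>R\<^esub> c)"

definition mult2 :: "('a, 'm) ring_scheme \<Rightarrow> 'a mat2 \<Rightarrow> 'a mat2 \<Rightarrow> 'a mat2" where
  "mult2 R = (\<lambda>(a, b, c, d) (a', b', c', d').
     (a \<otimes>\<^bsub>R\<^esub> a' \<oplus>\<^bsub>R\<^esub> b \<otimes>\<^bsub>R\<^esub> c', a \<otimes>\<^bsub>R\<^esub> b' \<oplus>\<^bsub>R\<^esub> b \<otimes>\<^bsub>R\<^esub> d',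
      c \<otimes>\<^bsub>R\<^esub> a' \<oplus>\<^bsub>R\<^esub> d \<otimes>\<^bsub>R\<^esub> c', c \<otimes>\<^bsub>R\<^esub> b' \<oplus>\<^bsub>R\<^esub> d \<otimes>\<^bsub>R\<^esub> d'))"

definition SL2 :: "('a, 'm) ring_scheme \<Rightarrow> 'a mat2 monoid" where
  "SL2 R = \<lparr>carrier = {A \<in> carrier R \<times> carrier R \<times> carrier R \<times> carrier R. det2 R A = \<one>\<^bsub>R\<^esub>},
            monoid.mult = mult2 R,
            one = (\<one>\<^bsub>R\<^esub>, \<zero>\<^bsub>R\<^esub>, \<zero>\<^bsub>R\<^esub>, \<one>\<^bsub>R\<^esub>)\<rparr>"

definition center :: "('a, 'm) monoid_scheme \<Rightarrow> 'a set" where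
  "center G = {z \<in> carrier G. \<forall>x \<in> carrier G. z \<otimes>\<^bsub>G\<^esub> x = x \<otimes>\<^bsub>G\<^esub> z}"

definition PSL2 :: "('a, 'm) ring_scheme \<Rightarrow> 'a mat2 set monoid" where
  "PSL2 R = SL2 R Mod center (SL2 R)"

lemma (in cring) group_SL2: "group (SL2 R)"
proof (rule groupI)
  fix A B assume "A \<in> carrier (SL2 R)" "B \<in> carrier (SL2 R)"
  then obtain a b c d a' b' c' d' where
    [simp]: "A = (a, b, c, d)" "B = (a', b', c', d')"
    and carr[simp]: "a \<in> carrier R" "b \<in> carrier R" "c \<in> carrier R" "d \<in> carrier R"
    "a' \<in> carrier R" "b' \<in> carrier R" "c' \<in> carrier R" "d' \<in> carrier R"
    and det: "a \<otimes> d \<ominus> b \<otimes> c = \<one>" "a' \<otimes> d' \<ominus> b' \<otimes> c' = \<one>"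
    by (cases A; cases B) (auto simp: SL2_def det2_def)
  have "(a \<otimes> a' \<oplus> b \<otimes> c') \<otimes> (c \<otimes> b' \<oplus> d \<otimes> d') \<ominus> (a \<otimes> b' \<oplus> b \<otimes> d') \<otimes> (c \<otimes> a' \<oplus> d \<otimes> c')
      = (a \<otimes> d \<ominus> b \<otimes> c) \<otimes> (a' \<otimes> d' \<ominus> b' \<otimes> c')"
    using carr by algebra
  then show "A \<otimes>\<^bsub>SL2 R\<^esub> B \<in> carrier (SL2 R)"
    using det by (simp add: SL2_def det2_def mult2_def)
next
  show "\<one>\<^bsub>SL2 R\<^esub> \<in> carrier (SL2 R)"
    by (simp add: SL2_def det2_def minus_eq)
next
  fix A B C assume "A \<in> carrier (SL2 R)" "B \<in> carrier (SL2 R)" "C \<in> carrier (SL2 R)"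
  then show "A \<otimes>\<^bsub>SL2 R\<^esub> B \<otimes>\<^bsub>SL2 R\<^esub> C = A \<otimes>\<^bsub>SL2 R\<^esub> (B \<otimes>\<^bsub>SL2 R\<^esub> C)"
    by (auto simp: SL2_def mult2_def l_distr r_distr m_assoc a_ac)
next
  fix A assume "A \<in> carrier (SL2 R)"
  then show "\<one>\<^bsub>SL2 R\<^esub> \<otimes>\<^bsub>SL2 R\<^esub> A = A"
    by (auto simp: SL2_def mult2_def)
next
  fix A assume "A \<in> carrier (SL2 R)"
  then obtain a b c d where [simp]: "A = (a, b, c, d)"
    and carr[simp]: "a \<in> carrier R" "b \<in> carrier R" "c \<in> carrier R" "d \<in> carrier R"
    and det: "a \<otimes> d \<ominus> b \<otimes> c = \<one>"
    by (cases A) (auto simp: SL2_def det2_def)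
  have "d \<otimes> a \<oplus> \<ominus> b \<otimes> c = \<one>" "d \<otimes> b \<oplus> \<ominus> b \<otimes> d = \<zero>"
    "\<ominus> c \<otimes> a \<oplus> a \<otimes> c = \<zero>" "\<ominus> c \<otimes> b \<oplus> a \<otimes> d = \<one>" "d \<otimes> a \<ominus> \<ominus> b \<otimes> \<ominus> c = \<one>"
    using carr det by algebra+
  then show "\<exists>B \<in> carrier (SL2 R). B \<otimes>\<^bsub>SL2 R\<^esub> A = \<one>\<^bsub>SL2 R\<^esub>"
    by (intro bexI[of _ "(d, \<ominus> b, \<ominus> c, a)"]) (simp_all add: SL2_def mult2_def det2_def)
qed

lemma (in group) center_normal: "center G \<lhd> G"
proof -
  have carr [simp]: "z \<in> carrier G" if "z \<in> center G" for z
    using that unfolding center_def by blast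
  have comm: "z \<otimes> x = x \<otimes> z" if "z \<in> center G" "x \<in> carrier G" for z x
    using that unfolding center_def by blast
  have centerI: "z \<in> center G" if "z \<in> carrier G" "\<And>x. x \<in> carrier G \<Longrightarrow> z \<otimes> x = x \<otimes> z" for z
    using that unfolding center_def by blast
  have "subgroup (center G) G"
  proof (rule subgroupI)
    show "center G \<subseteq> carrier G" by (blast intro: carr)
    have "\<one> \<in> center G" by (rule centerI) auto
    then show "center G \<noteq> {}" by blast
  next
    fix z assume z: "z \<in> center G"
    show "inv z \<in> center G"
    proof (rule centerI)
      fix x assume x: "x \<in> carrier G"
      have "inv z \<otimes> x = inv z \<otimes> (x \<otimes> z) \<otimes> inv z"
        using z x by (simp add: m_assoc)
      also have "\<dots> = inv z \<otimes> (z \<otimes> x) \<otimes> inv z"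
        using z x by (simp only: comm)
      also have "\<dots> = x \<otimes> inv z"
        using z x by (simp flip: m_assoc)
      finally show "inv z \<otimes> x = x \<otimes> inv z" .
    qed (use z in simp)
  next
    fix a b assume ab: "a \<in> center G" "b \<in> center G"
    show "a \<otimes> b \<in> center G"
    proof (rule centerI)
      fix x assume x: "x \<in> carrier G"
      have "a \<otimes> b \<otimes> x = a \<otimes> (x \<otimes> b)"
        using ab x by (simp add: m_assoc comm[of b x])
      also have "\<dots> = x \<otimes> a \<otimes> b"
        using ab x by (simp add: comm[of a x] flip: m_assoc)
      finally show "a \<otimes> b \<otimes> x = x \<otimes> (a \<otimes> b)"
        using ab x by (simp add: m_assoc)
    qed (use ab in simp)
  qed
  moreover have "x \<otimes> h \<otimes> inv x \<in> center G" if "x \<in> carrier G" "h \<in> center G" for x h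
  proof -
    have "x \<otimes> h \<otimes> inv x = h \<otimes> x \<otimes> inv x"
      using that by (simp add: comm[of h x])
    also have "\<dots> = h"
      using that by (simp add: m_assoc)
    finally show ?thesis using that by simp
  qed
  ultimately show ?thesis by (simp add: normal_inv_iff)
qed

lemma (in cring) group_PSL2: "group (PSL2 R)"
  unfolding PSL2_def by (intro normal.factorgroup_is_group group.center_normal group_SL2)


section \<open>Irredundant generating sequences and the replacement property\<close>

definition generating_seq :: "('a, 'm) monoid_scheme \<Rightarrow> 'a list \<Rightarrow> bool" where
  "generating_seq G s \<longleftrightarrow> set s \<subseteq> carrier G \<and> generate G (set s) = carrier G"

definition irredundant_generating_seq :: "('a, 'm) monoid_scheme \<Rightarrow> 'a list \<Rightarrow> bool" where
  "irredundant_generating_seq G s \<longleftrightarrow>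
     generating_seq G s \<and> (\<forall>j < length s. \<not> generating_seq G (take j s @ drop (Suc j) s))"

text \<open>For a finite group the set below is finite and nonempty, so \<^const>\<open>Max\<close> is meaningful.\<close>

definition max_irredundant_length :: "('a, 'm) monoid_scheme \<Rightarrow> nat" where
  "max_irredundant_length G = Max {length s | s. irredundant_generating_seq G s}"

definition replacement_property_for :: "('a, 'm) monoid_scheme \<Rightarrow> 'a list \<Rightarrow> bool" where
  "replacement_property_for G s \<longleftrightarrow>
     (\<forall>g \<in> carrier G. g \<noteq> \<one>\<^bsub>G\<^esub> \<longrightarrow> (\<exists>i < length s. generating_seq G (s[i := g])))"

definition replacement_property :: "('a, 'm) monoid_scheme \<Rightarrow> bool" where
  "replacement_property G \<longleftrightarrow>
     (\<forall>s. irredundant_generating_seq G s \<and> length s = max_irredundant_length G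
        \<longrightarrow> replacement_property_for G s)"

end

theory Submission
  imports Defs "Berlekamp_Zassenhaus.Finite_Field" "HOL-Number_Theory.Residue_Primitive_Roots"
begin

text \<open>
  It suffices to find elements \<open>g\<^sub>1, g\<^sub>2, g\<^sub>3\<close> generating the group, a nontrivial \<open>g\<close>, and three proper
  subgroups, each containing \<open>g\<close> and two of the \<open>g\<^sub>i\<close>: then the sequence is irredundant and
  replacing any entry by \<open>g\<close> stays inside one of these subgroups. For \<open>p \<equiv> 1 (mod 8)\<close> the field
  contains square roots of \<open>- 1\<close> and \<open>2\<close>, so that matrices can be written as quaternions and the
  rotations of a cube act. The involution \<open>g\<close> is an edge half-turn of a cube, two of the
  subgroups are octahedral groups of cubes that share a diagonal and this half-turn (they meet in
  a dihedral group of order six), and the third one is the centraliser of \<open>g\<close>.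

  Let \<open>H\<close> be the group generated by the \<open>g\<^sub>i\<close>. If \<open>H\<close> contains a unipotent element, then it is
  everything, since it contains anticommuting matrices and so lies in no Borel subgroup.
  Otherwise every nontrivial element of \<open>H\<close> fixes exactly two poles, and the count of poles
  familiar from the finite rotation groups applies. The product \<open>g\<^sub>1 g\<^sub>2\<close> is a rotation with
  cosine of the half-angle \<open>- 1/3\<close>, whose order is at least six as \<open>p > 11\<close>; this forces \<open>H\<close> to
  have an abelian subgroup of index at most two, which is impossible in the presence of an
  octahedral group.
\<close>

section \<open>Two-by-two matrices\<close>

datatype 'a m2 = M2 (e11: 'a) (e12: 'a) (e21: 'a) (e22: 'a)

lemma m2_eq_iff: "x = y \<longleftrightarrow> e11 x = e11 y \<and> e12 x = e12 y \<and> e21 x = e21 y \<and> e22 x = e22 y"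
  by (cases x; cases y) auto

instantiation m2 :: (comm_ring_1) ring_1
begin
definition "0 = M2 0 0 0 0"
definition "1 = M2 1 0 0 1"
definition "- x = M2 (- e11 x) (- e12 x) (- e21 x) (- e22 x)"
definition "x + y = M2 (e11 x + e11 y) (e12 x + e12 y) (e21 x + e21 y) (e22 x + e22 y)"
definition "x - y = M2 (e11 x - e11 y) (e12 x - e12 y) (e21 x - e21 y) (e22 x - e22 y)"
definition "x * y = M2 (e11 x * e11 y + e12 x * e21 y) (e11 x * e12 y + e12 x * e22 y)
                       (e21 x * e11 y + e22 x * e21 y) (e21 x * e12 y + e22 x * e22 y)"
instance
  by standard (auto simp: zero_m2_def one_m2_def uminus_m2_def plus_m2_def minus_m2_def
      times_m2_def algebra_simps)
end

lemmas m2_defs = zero_m2_def one_m2_def uminus_m2_def plus_m2_def minus_m2_def times_m2_def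

instance m2 :: (finite) finite
proof
  have "(UNIV :: 'a m2 set) \<subseteq> (\<lambda>(a, b, c, d). M2 a b c d) ` UNIV"
    by (auto simp: image_def) (metis m2.exhaust)
  then show "finite (UNIV :: 'a m2 set)"
    by (rule finite_subset) auto
qed

definition det :: "'a::comm_ring_1 m2 \<Rightarrow> 'a" where
  "det x = e11 x * e22 x - e12 x * e21 x"

definition tr :: "'a::comm_ring_1 m2 \<Rightarrow> 'a" where
  "tr x = e11 x + e22 x"

definition adj :: "'a::comm_ring_1 m2 \<Rightarrow> 'a m2" where
  "adj x = M2 (e22 x) (- e12 x) (- e21 x) (e11 x)"

definition scal :: "'a::comm_ring_1 \<Rightarrow> 'a m2" where
  "scal l = M2 l 0 0 l"

lemma det_mult [simp]: "det (x * y) = det x * det y"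
  by (simp add: det_def times_m2_def algebra_simps)

lemma det_one [simp]: "det 1 = 1" and det_minus [simp]: "det (- x) = det x"
  and det_adj [simp]: "det (adj x) = det x" and det_scal [simp]: "det (scal l) = l ^ 2"
  by (simp_all add: det_def m2_defs adj_def scal_def power2_eq_square algebra_simps)

lemma adj_mult: "adj (x * y) = adj y * adj x"
  by (simp add: adj_def times_m2_def algebra_simps)

lemma adj_adj [simp]: "adj (adj x) = x"
  by (simp add: adj_def m2_eq_iff)

lemma adj_minus: "adj (- x) = - adj x"
  by (simp add: adj_def uminus_m2_def)

lemma mult_adj: "x * adj x = scal (det x)" and adj_mult_self: "adj x * x = scal (det x)"
  by (simp_all add: det_def times_m2_def adj_def scal_def algebra_simps)

lemma scal_one [simp]: "scal 1 = 1"
  by (simp add: scal_def one_m2_def)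

lemma scal_minus: "scal (- l) = - scal l"
  by (simp add: scal_def uminus_m2_def)

lemma scal_commute: "x * scal l = scal l * x"
  by (simp add: times_m2_def scal_def mult.commute)

lemma scal_mult: "scal k * scal l = scal (k * l)"
  by (simp add: times_m2_def scal_def)

lemma scal_mult_mult: "scal k * x * (scal l * y) = scal (k * l) * (x * y)"
proof -
  have "x * (scal l * y) = scal l * (x * y)"
    by (simp add: scal_commute[of x] flip: mult.assoc)
  then show ?thesis
    by (simp add: mult.assoc flip: scal_mult)
qed

lemma scal_intertwine: "x * q = q' * x \<Longrightarrow> scal k * x * q = q' * (scal k * x)"
  by (simp add: scal_commute[of q'] mult.assoc flip: mult.assoc[of q'])

lemma tr_commute: "tr (x * y) = tr (y * x)"
  by (simp add: tr_def times_m2_def algebra_simps)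

lemma tr_scal [simp]: "tr (scal l * x) = l * tr x"
  by (simp add: tr_def times_m2_def scal_def algebra_simps)

lemma tr_minus [simp]: "tr (- x) = - tr x"
  by (simp add: tr_def uminus_m2_def)

lemma det_one_inverse [simp]:
  assumes "det x = 1"
  shows "x * adj x = 1" "adj x * x = 1" "x * (adj x * y) = y" "adj x * (x * y) = y"
  using assms by (simp_all add: mult_adj adj_mult_self flip: mult.assoc)

lemma scal_cancel:
  fixes l :: "'a::field"
  assumes "l \<noteq> 0" "scal l * x = scal l * y"
  shows "x = y"
proof -
  have "scal (inverse l) * (scal l * x) = scal (inverse l) * (scal l * y)"
    using assms(2) by simp
  then show ?thesis
    using assms(1) by (simp add: scal_mult flip: mult.assoc)
qed

section \<open>The action of SL(2, F) by conjugation\<close>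

definition conjm :: "'a::comm_ring_1 m2 \<Rightarrow> 'a m2 \<Rightarrow> 'a m2" where
  "conjm x v = x * v * adj x"

lemma conjm_mult: "conjm (x * y) v = conjm x (conjm y v)"
  by (simp add: conjm_def adj_mult mult.assoc)

lemma conjm_one [simp]: "conjm 1 v = v"
  by (simp add: conjm_def adj_def m2_defs)

lemma conjm_minus [simp]: "conjm (- x) v = conjm x v"
  by (simp add: conjm_def adj_minus)

text \<open>As \<open>adj x\<close> is the inverse of \<open>x\<close>, multiplying by
  \<open>x\<close> on the right trades the conjugation for an identity without inverses.\<close>

lemma conjm_eq_iff:
  assumes "det x = 1"
  shows "conjm x v = w \<longleftrightarrow> x * v = w * x"
proof
  assume "conjm x v = w"
  then have "conjm x v * x = w * x"
    by simp
  then show "x * v = w * x"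
    using assms by (simp add: conjm_def mult.assoc)
next
  assume "x * v = w * x"
  then show "conjm x v = w"
    using assms by (simp add: conjm_def mult.assoc)
qed

lemma conjm_adj_conjm [simp]: "det x = 1 \<Longrightarrow> conjm (adj x) (conjm x v) = v"
  and conjm_conjm_adj [simp]: "det x = 1 \<Longrightarrow> conjm x (conjm (adj x) v) = v"
  by (simp_all flip: conjm_mult)

lemma det_cnj [simp]: "det x = 1 \<Longrightarrow> det (conjm x v) = det v"
  by (simp add: conjm_def)

lemma tr_cnj [simp]: "det x = 1 \<Longrightarrow> tr (conjm x v) = tr v"
  using tr_commute[of "x * v" "adj x"] by (simp add: conjm_def)

lemma conjm_scal: "conjm x (scal l * v) = scal l * conjm x v"
proof -
  have "x * (scal l * v) = scal l * (x * v)"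
    by (simp add: scal_commute[of x] flip: mult.assoc)
  then show ?thesis
    by (simp add: conjm_def mult.assoc)
qed

section \<open>Finite subgroups of SL(2, F), their centralisers and orbits\<close>

locale sl2_subgroup =
  fixes H :: "'a::{field,finite} m2 set"
  assumes det_H: "x \<in> H \<Longrightarrow> det x = 1"
    and one_H [simp]: "1 \<in> H"
    and mult_H [simp]: "x \<in> H \<Longrightarrow> y \<in> H \<Longrightarrow> x * y \<in> H"
    and adj_H [simp]: "x \<in> H \<Longrightarrow> adj x \<in> H"
begin

definition Cent :: "'a m2 \<Rightarrow> 'a m2 set" where
  "Cent v = {x \<in> H. x * v = v * x}"

definition orb :: "'a m2 \<Rightarrow> 'a m2 set" where
  "orb v = (\<lambda>x. conjm x v) ` H"

lemma Cent_iff: "x \<in> Cent v \<longleftrightarrow> x \<in> H \<and> conjm x v = v"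
  unfolding Cent_def using conjm_eq_iff[OF det_H, of x v v] by auto

lemma orb_self [simp]: "v \<in> orb v"
  unfolding orb_def by (rule image_eqI[of _ _ 1]) auto

lemma orb_eq:
  assumes "w \<in> orb v"
  shows "orb w = orb v"
proof -
  obtain y where y: "y \<in> H" "w = conjm y v"
    using assms by (auto simp: orb_def)
  then have v: "v = conjm (adj y) w"
    by (simp add: det_H)
  show ?thesis
  proof
    show "orb w \<subseteq> orb v"
      using y by (auto simp: orb_def simp flip: conjm_mult)
    have "conjm x v = conjm (x * adj y) w" for x
      by (simp add: v conjm_mult)
    then show "orb v \<subseteq> orb w"
      using y(1) unfolding orb_def by auto
  qed
qed

lemma orb_disjoint: "v \<notin> orb w \<Longrightarrow> orb v \<inter> orb w = {}"
  using orb_eq orb_self by blast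

text \<open>Orbit-stabiliser theorem: the fibre over \<open>conjm y v\<close> is the left coset of
  \<open>Cent v\<close> by \<open>y\<close>.\<close>

lemma orb_Cent: "card (orb v) * card (Cent v) = card H"
proof -
  have fibre: "card {x \<in> H. conjm x v = w} = card (Cent v)" if w: "w \<in> orb v" for w
  proof -
    obtain y where y: "y \<in> H" "w = conjm y v"
      using w by (auto simp: orb_def)
    have "bij_betw (\<lambda>x. y * x) (Cent v) {x \<in> H. conjm x v = w}"
    proof (rule bij_betwI[where g = "\<lambda>x. adj y * x"])
      show "(*) y \<in> Cent v \<rightarrow> {x \<in> H. conjm x v = w}"
        using y by (auto simp: Cent_iff conjm_mult det_H)
      show "(*) (adj y) \<in> {x \<in> H. conjm x v = w} \<rightarrow> Cent v"
        using y by (auto simp: Cent_iff conjm_mult det_H)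
    qed (use y in \<open>auto simp: det_H\<close>)
    then show ?thesis
      by (simp add: bij_betw_same_card)
  qed
  have "card H = (\<Sum>w\<in>orb v. card {x \<in> H. conjm x v = w})"
    unfolding orb_def using sum.image_gen[of H "\<lambda>_. 1::nat" "\<lambda>x. conjm x v"] by simp
  also have "\<dots> = card (orb v) * card (Cent v)"
    by (simp add: fibre)
  finally show ?thesis ..
qed

lemma card_Cent_orb:
  assumes "w \<in> orb v"
  shows "card (Cent w) = card (Cent v)"
proof -
  have "card (orb v) > 0"
    by (metis card_gt_0_iff emptyE finite orb_self)
  then show ?thesis
    using orb_Cent[of v] orb_Cent[of w] orb_eq[OF assms] by (metis mult_left_cancel not_gr0)
qed

end

section \<open>Counting axes\<close>

text \<open>A fixed representative of the class of \<open>c\<close> modulo nonzero squares.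
  Rescaling a matrix by \<open>l\<close> multiplies its determinant by \<open>l ^ 2\<close>, so this
  is the best normalisation of determinants when square roots may be missing.\<close>

definition sq_rep :: "'a::field \<Rightarrow> 'a" where
  "sq_rep c = (SOME d. \<exists>l. l \<noteq> 0 \<and> d = l ^ 2 * c)"

lemma sq_rep_ex: "\<exists>l. l \<noteq> 0 \<and> sq_rep c = l ^ 2 * c"
proof -
  have "\<exists>l. l \<noteq> 0 \<and> c = l ^ 2 * c"
    by (rule exI[of _ 1]) simp
  then show ?thesis
    unfolding sq_rep_def by (rule someI)
qed

lemma sq_rep_mult:
  assumes "l \<noteq> 0"
  shows "sq_rep (l ^ 2 * c) = sq_rep c"
proof -
  have "(\<exists>k. k \<noteq> 0 \<and> d = k ^ 2 * (l ^ 2 * c)) \<longleftrightarrow> (\<exists>k. k \<noteq> 0 \<and> d = k ^ 2 * c)" for d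
  proof
    assume "\<exists>k. k \<noteq> 0 \<and> d = k ^ 2 * (l ^ 2 * c)"
    then obtain k where "k \<noteq> 0" "d = k ^ 2 * (l ^ 2 * c)" by blast
    then show "\<exists>k. k \<noteq> 0 \<and> d = k ^ 2 * c"
      using assms by (intro exI[of _ "k * l"]) (simp add: power_mult_distrib)
  next
    assume "\<exists>k. k \<noteq> 0 \<and> d = k ^ 2 * c"
    then obtain k where "k \<noteq> 0" "d = k ^ 2 * c" by blast
    then show "\<exists>k. k \<noteq> 0 \<and> d = k ^ 2 * (l ^ 2 * c)"
      using assms by (intro exI[of _ "k / l"]) (simp add: power_divide)
  qed
  then show ?thesis
    by (simp add: sq_rep_def)
qed

text \<open>Each line spanned by a traceless matrix of nonzero determinant contains exactly two members
  \<open>v\<close> and \<open>- v\<close> of the following set; they play the part of the two poles of a rotation.\<close>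

definition poles :: "'a::field m2 set" where
  "poles = {v. tr v = 0 \<and> det v \<noteq> 0 \<and> sq_rep (det v) = det v}"

lemma pole_exists:
  assumes "tr v = 0" "det v \<noteq> 0"
  obtains l where "l \<noteq> 0" "scal l * v \<in> poles"
proof -
  obtain l where "l \<noteq> 0" "sq_rep (det v) = l ^ 2 * det v"
    using sq_rep_ex by blast
  then show thesis
    using that[of l] assms by (simp add: poles_def sq_rep_mult)
qed

lemma conjm_poles: "det x = 1 \<Longrightarrow> v \<in> poles \<Longrightarrow> conjm x v \<in> poles"
  by (simp add: poles_def)

section \<open>The axis of a matrix\<close>

definition axis :: "'a::comm_ring_1 m2 \<Rightarrow> 'a m2" where
  "axis x = scal 2 * x - scal (tr x)"

lemma tr_axis: "tr (axis x) = 0"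
  by (simp add: axis_def tr_def scal_def minus_m2_def times_m2_def)

text \<open>Up to sign this is the discriminant of the characteristic polynomial, so it vanishes
  exactly for a double eigenvalue.\<close>

lemma det_axis: "det (axis x) = 4 * det x - (tr x) ^ 2"
  by (simp add: axis_def tr_def det_def scal_def minus_m2_def times_m2_def power2_eq_square
      algebra_simps)

lemma axis_commute: "x * axis x = axis x * x"
  by (simp add: axis_def right_diff_distrib left_diff_distrib scal_commute[of x] flip: mult.assoc)

text \<open>The matrices commuting with a non-scalar \<open>x\<close> are spanned by
  \<open>1\<close> and \<open>x\<close>; the traceless ones among them form a line.\<close>

lemma commute_axis:
  fixes x v :: "'a::field m2"
  assumes "(2::'a) \<noteq> 0" "det (axis x) \<noteq> 0" "tr v = 0" "x * v = v * x"
  obtains m where "v = scal m * axis x"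
proof -
  obtain a b c d where x: "x = M2 a b c d" by (cases x)
  obtain \<alpha> \<beta> \<gamma> where v: "v = M2 \<alpha> \<beta> \<gamma> (- \<alpha>)"
    using assms(3) by (cases v) (auto simp: tr_def add_eq_0_iff)
  have ax: "axis x = M2 (a - d) (2 * b) (2 * c) (d - a)"
    by (simp add: axis_def x tr_def scal_def minus_m2_def times_m2_def)
  \<comment> \<open>The 2 by 2 minors of the coordinate vectors of \<open>v\<close> and
    \<open>axis x\<close> vanish, so the vectors are proportional; the factor is read off at a
    nonzero coordinate of \<open>axis x\<close>.\<close>
  have e: "b * \<gamma> = \<beta> * c" "(a - d) * \<beta> = 2 * \<alpha> * b" "2 * c * \<alpha> = (a - d) * \<gamma>"
  proof -
    have c: "a * \<alpha> + b * \<gamma> = \<alpha> * a + \<beta> * c" "a * \<beta> + b * - \<alpha> = \<alpha> * b + \<beta> * d"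
      "c * \<alpha> + d * \<gamma> = \<gamma> * a + - \<alpha> * c"
      using assms(4) unfolding x v times_m2_def by simp_all
    have "b * \<gamma> - \<beta> * c = (a * \<alpha> + b * \<gamma>) - (\<alpha> * a + \<beta> * c)"
      "(a - d) * \<beta> - 2 * \<alpha> * b = (a * \<beta> + b * - \<alpha>) - (\<alpha> * b + \<beta> * d)"
      "2 * c * \<alpha> - (a - d) * \<gamma> = (c * \<alpha> + d * \<gamma>) - (\<gamma> * a + - \<alpha> * c)"
      by (simp_all add: algebra_simps)
    then show "b * \<gamma> = \<beta> * c" "(a - d) * \<beta> = 2 * \<alpha> * b" "2 * c * \<alpha> = (a - d) * \<gamma>"
      unfolding c by simp_all
  qed
  note thesisI = that
  have ne: "\<not> (a = d \<and> b = 0 \<and> c = 0)"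
    using assms(2) by (auto simp: ax det_def)
  have witness: thesis if m: "\<alpha> = m * (a - d)" "\<beta> = m * (2 * b)" "\<gamma> = m * (2 * c)" for m
    by (rule thesisI[of m]) (use m in \<open>simp add: v ax scal_def times_m2_def right_diff_distrib\<close>)
  show thesis
  proof (cases "a = d")
    case False
    then have k: "a - d \<noteq> 0"
      by simp
    have "\<beta> = 2 * \<alpha> * b / (a - d)" "\<gamma> = 2 * c * \<alpha> / (a - d)"
      using k e(2,3) by (simp_all add: eq_divide_eq mult.commute)
    then show thesis
      using k by (intro witness[of "\<alpha> / (a - d)"]) simp_all
  next
    case True
    then have e': "\<alpha> * b = 0" "\<alpha> * c = 0"
      using e(2,3) assms(1) by auto
    show thesis
    proof (cases "b = 0")
      case False
      then have "\<gamma> = \<beta> * c / b"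
        using e(1) by (simp add: eq_divide_eq mult.commute)
      then show thesis
        using False True e' assms(1) by (intro witness[of "\<beta> / (2 * b)"]) simp_all
    next
      case b: True
      then have c: "c \<noteq> 0"
        using ne True by blast
      then have "\<beta> = 0"
        using e(1) b by simp
      then show thesis
        using b c True e' assms(1) by (intro witness[of "\<gamma> / (2 * c)"]) simp_all
    qed
  qed
qed

text \<open>For determinant one, trace 2 or -2 means a double eigenvalue 1 or -1. Thus
  \<open>semisimple\<close> says that \<open>1\<close> is the only unipotent element of
  \<open>H\<close>.\<close>

locale sl2_semisimple = sl2_subgroup +
  assumes minus_one_H [simp]: "- 1 \<in> H"
    and two_nonzero: "(2::'a) \<noteq> 0"
    and semisimple: "x \<in> H \<Longrightarrow> x \<noteq> 1 \<Longrightarrow> x \<noteq> - 1 \<Longrightarrow> (tr x) ^ 2 \<noteq> 4"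
begin

lemma neq_minus: "det v \<noteq> 0 \<Longrightarrow> v \<noteq> - v" for v :: "'a m2"
proof
  assume d: "det v \<noteq> 0" and v: "v = - v"
  have 0: "y = 0" if "y = - y" for y :: 'a
  proof -
    have "2 * y = 0" using that by (metis add.right_inverse mult_2)
    then show ?thesis using two_nonzero by simp
  qed
  have "e11 v = - e11 v" "e12 v = - e12 v"
    by (subst v, simp add: uminus_m2_def)+
  then have "e11 v = 0" "e12 v = 0"
    by (blast intro: 0)+
  then show False
    using d by (simp add: det_def)
qed

lemma one_neq_minus_one: "(1::'a m2) \<noteq> - 1"
  by (rule neq_minus) simp

lemma card_poles_commuting:
  assumes "x \<in> H - {1, - 1}"
  shows "card {v \<in> poles. x * v = v * x} = 2"
proof -
  have "det (axis x) = 4 - (tr x) ^ 2"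
    using assms by (simp add: det_axis det_H)
  then have d: "det (axis x) \<noteq> 0"
    using assms semisimple[of x] by auto
  obtain l where l: "l \<noteq> 0" "scal l * axis x \<in> poles"
    using pole_exists[OF tr_axis d] .
  define w where "w = scal l * axis x"
  have "v = w \<or> v = - w" if v: "v \<in> poles" "x * v = v * x" for v
  proof -
    obtain m where m: "v = scal m * axis x"
      using commute_axis[OF two_nonzero d _ v(2)] v(1) by (auto simp: poles_def)
    then have "m \<noteq> 0"
      using v(1) by (auto simp: poles_def)
    \<comment> \<open>Both \<open>v\<close> and \<open>w\<close> carry the chosen determinant of the
      square class of \<open>det (axis x)\<close>.\<close>
    then have "m ^ 2 * det (axis x) = l ^ 2 * det (axis x)"
      using v(1) l unfolding poles_def m by (simp add: sq_rep_mult)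
    then have "m = l \<or> m = - l"
      using d by (simp add: power2_eq_iff)
    then show ?thesis
      by (auto simp: m w_def scal_minus)
  qed
  moreover have "w \<in> poles" "- w \<in> poles"
    using l(2) by (auto simp: poles_def w_def)
  moreover have "x * w = w * x"
    unfolding w_def by (simp add: scal_commute[of x] mult.assoc axis_commute flip: mult.assoc[of x])
  ultimately have "{v \<in> poles. x * v = v * x} = {w, - w}"
    by auto
  moreover have "w \<noteq> - w"
    using l(1) d by (intro neq_minus) (simp add: w_def)
  ultimately show ?thesis
    by simp
qed

definition fixers :: "'a m2 \<Rightarrow> 'a m2 set" where
  "fixers v = Cent v - {1, - 1}"

lemma pm_one_Cent: "{1, - 1} \<subseteq> Cent v"
  by (simp add: Cent_def)

lemma card_Cent: "card (Cent v) = card (fixers v) + 2"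
  using card_Diff_subset[of "{1, - 1}" "Cent v"] pm_one_Cent[of v] card_mono[of "Cent v" "{1, - 1}"]
    one_neq_minus_one
  by (simp add: fixers_def)

text \<open>Double counting of commuting pairs: every element of \<open>H\<close> other than
  \<open>1\<close> and \<open>- 1\<close> fixes two poles.\<close>

lemma sum_fixers: "(\<Sum>v\<in>poles. card (fixers v)) = 2 * (card H - 2)"
proof -
  have "fixers v = {x \<in> H - {1, - 1}. x * v = v * x}" for v
    by (auto simp: fixers_def Cent_def)
  then have "(\<Sum>v\<in>poles. card (fixers v)) = (\<Sum>v\<in>poles. \<Sum>x\<in>{x \<in> H - {1, - 1}. x * v = v * x}. 1)"
    by simp
  also have "\<dots> = (\<Sum>x\<in>H - {1, - 1}. \<Sum>v\<in>{v \<in> poles. x * v = v * x}. 1)"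
    using sum.swap_restrict[of poles "H - {1, - 1}" "\<lambda>_ _. 1::nat" "\<lambda>v x. x * v = v * x"]
    by simp
  also have "\<dots> = (\<Sum>x\<in>H - {1, - 1}. 2)"
    by (intro sum.cong) (use card_poles_commuting in simp_all)
  also have "\<dots> = 2 * (card H - 2)"
    using card_Diff_subset[of "{1, - 1}" H] one_neq_minus_one by simp
  finally show ?thesis .
qed

lemma even_card_Cent: "even (card (Cent v))"
proof -
  define C where "C = (\<lambda>x. {x, - x}) ` Cent v"
  have minus: "- x \<in> Cent v" if "x \<in> Cent v" for x
    using that mult_H[OF minus_one_H, of x] by (auto simp: Cent_def)
  have "card c = 2" if "c \<in> C" for c
    using that det_H neq_minus by (auto simp: C_def Cent_def)
  moreover have "c1 \<inter> c2 = {}" if "c1 \<in> C" "c2 \<in> C" "c1 \<noteq> c2" for c1 c2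
    using that by (auto simp: C_def)
  moreover have "\<Union>C = Cent v"
    using minus by (auto simp: C_def)
  ultimately have "2 * card C = card (Cent v)"
    using card_partition[of C 2] by simp
  then show ?thesis
    by (metis dvd_triv_left)
qed

text \<open>\<open>Cent v\<close> has even order greater than two, hence order four or at least
  six.\<close>

lemma orbit_bounds:
  assumes "fixers v \<noteq> {}"
  shows "4 * card (orb v) \<le> card H"
    and "6 * card (orb v) \<le> card H \<or> 4 * card (orb v) = card H"
proof -
  have "card (fixers v) \<noteq> 0"
    using assms by simp
  then have "card (Cent v) > 2"
    using card_Cent[of v] by linarith
  with even_card_Cent[of v] have "card (Cent v) = 4 \<or> card (Cent v) \<ge> 6"
    by presburger
  with orb_Cent[of v] mult_le_mono2[of 6 "card (Cent v)" "card (orb v)"]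
  show "4 * card (orb v) \<le> card H" "6 * card (orb v) \<le> card H \<or> 4 * card (orb v) = card H"
    by (auto simp: mult.commute)
qed

text \<open>Each of the \<open>card (orb v)\<close> summands is \<open>card (Cent v) - 2\<close>,
  and orbit-stabiliser evaluates the product.\<close>

lemma sum_fixers_orb: "(\<Sum>w\<in>orb v. card (fixers w)) + 2 * card (orb v) = card H"
proof -
  have "(\<Sum>w\<in>orb v. card (fixers w)) = (\<Sum>w\<in>orb v. card (fixers v))"
    by (intro sum.cong refl) (use card_Cent_orb card_Cent in fastforce)
  then show ?thesis
    using orb_Cent[of v] by (simp add: card_Cent algebra_simps)
qed

text \<open>The classical count behind the list of finite rotation groups: there are exactly three
  orbits of poles unless \<open>H\<close> fixes a pole, and an axis of order at least six leaves
  only the dihedral case.\<close>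

lemma card_orb_le_2:
  assumes v1: "v1 \<in> poles" and n1: "card (Cent v1) \<ge> 12"
  shows "card (orb v1) \<le> 2"
proof -
  define P where "P = {v \<in> poles. fixers v \<noteq> {}}"
  define S where "S A = (\<Sum>v\<in>A. card (fixers v))" for A
  have "S P = S poles"
    unfolding S_def P_def by (intro sum.mono_neutral_left) auto
  moreover have H2: "card H \<ge> 12"
    using n1 card_mono[of H "Cent v1"] by (auto simp: Cent_def)
  ultimately have SP: "S P + 4 = 2 * card H"
    using sum_fixers by (simp add: S_def)
  have orbP: "orb v \<subseteq> P" if "v \<in> P" for v
  proof
    fix w assume w: "w \<in> orb v"
    then have "card (fixers w) = card (fixers v)"
      using card_Cent_orb[OF w] card_Cent by simp
    moreover have "w \<in> poles"
      using w that by (auto simp: orb_def P_def intro!: conjm_poles det_H)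
    ultimately show "w \<in> P"
      using that by (auto simp: P_def card_eq_0_iff)
  qed
  have S_orb: "S (orb v) + 2 * card (orb v) = card H" for v
    by (simp add: S_def sum_fixers_orb)
  have S_Un: "S (A \<union> B) = S A + S B" if "A \<inter> B = {}" for A B
    unfolding S_def using that by (intro sum.union_disjoint) auto
  have S_mono: "S A \<le> S P" if "A \<subseteq> P" for A
    unfolding S_def using that by (intro sum_mono2) auto
  have v1P: "v1 \<in> P"
    using v1 n1 card_Cent[of v1] by (auto simp: P_def)
  \<comment> \<open>An axis of order six contributes twelve matrices, since each rotation has two
    lifts differing by sign.\<close>
  have b1: "12 * card (orb v1) \<le> card H"
    using orb_Cent[of v1] n1 mult_le_mono2[of 12 "card (Cent v1)" "card (orb v1)"]
    by (simp add: mult.commute)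
  have "S (orb v1) < S P"
    using S_orb[of v1] SP H2 by linarith
  then obtain v2 where v2: "v2 \<in> P" "v2 \<notin> orb v1"
    by (metis orbP v1P nat_less_le subset_antisym subsetI)
  have d12: "orb v1 \<inter> orb v2 = {}"
    using orb_disjoint[OF v2(2)] by blast
  have b2: "4 * card (orb v2) \<le> card H" "6 * card (orb v2) \<le> card H \<or> 4 * card (orb v2) = card H"
    using v2 orbit_bounds[of v2] by (auto simp: P_def)
  show ?thesis
  proof (cases "P = orb v1 \<union> orb v2")
    \<comment> \<open>With two orbits the count becomes
      \<open>card (orb v1) + card (orb v2) = 2\<close>.\<close>
    case True
    then show ?thesis
      using S_Un[OF d12] S_orb[of v1] S_orb[of v2] SP by simp
  next
    case False
    then obtain v3 where v3: "v3 \<in> P" "v3 \<notin> orb v1 \<union> orb v2"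
      using orbP v1P v2 by blast
    have d123: "(orb v1 \<union> orb v2) \<inter> orb v3 = {}"
      using orb_disjoint[of v3 v1] orb_disjoint[of v3 v2] v3 by blast
    have b3: "4 * card (orb v3) \<le> card H" "6 * card (orb v3) \<le> card H \<or> 4 * card (orb v3) = card H"
      using v3 orbit_bounds[of v3] by (auto simp: P_def)
    show ?thesis
    proof (cases "P = orb v1 \<union> orb v2 \<union> orb v3")
      \<comment> \<open>With three orbits twice the sum of their sizes is \<open>card H + 4\<close>.
        Since 1/12 + 1/6 + 1/4 = 1/2, the second and third must both have size
        \<open>card H / 4\<close>, which leaves size 2 for the first.\<close>
      case True
      then have "S (orb v1) + S (orb v2) + S (orb v3) + 4 = 2 * card H"
        using S_Un[OF d12] S_Un[OF d123] SP by simp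
      then show ?thesis
        using S_orb[of v1] S_orb[of v2] S_orb[of v3] b1 b2 b3 by linarith
    next
      case False
      then obtain v4 where v4: "v4 \<in> P" "v4 \<notin> orb v1 \<union> orb v2 \<union> orb v3"
        using orbP v1P v2 v3 by blast
      have d1234: "(orb v1 \<union> orb v2 \<union> orb v3) \<inter> orb v4 = {}"
        using orb_disjoint[of v4 v1] orb_disjoint[of v4 v2] orb_disjoint[of v4 v3] v4 by blast
      \<comment> \<open>Four orbits are too many: twice the sum of their sizes would be at least
        \<open>2 * card H + 4\<close>, but the bounds give at most 5/3 of
        \<open>card H\<close>.\<close>
      have "orb v1 \<union> orb v2 \<union> orb v3 \<union> orb v4 \<subseteq> P"
        using orbP v1P v2 v3 v4 by blast
      then have "S (orb v1) + S (orb v2) + S (orb v3) + S (orb v4) \<le> S P"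
        using S_Un[OF d12] S_Un[OF d123] S_Un[OF d1234] S_mono by metis
      moreover have "4 * card (orb v4) \<le> card H"
        using v4 orbit_bounds[of v4] by (auto simp: P_def)
      ultimately show ?thesis
        using S_orb[of v1] S_orb[of v2] S_orb[of v3] S_orb[of v4] b1 b2 b3 SP by linarith
    qed
  qed
qed

text \<open>A rescaling of \<open>v\<close> is a pole with the same centraliser, and its orbit has
  at most two members; the square of any permutation of two points is trivial.\<close>

lemma square_commutes:
  assumes v: "tr v = 0" "det v \<noteq> 0" and n: "card (Cent v) \<ge> 12" and x: "x \<in> H"
  shows "x * x * v = v * (x * x)"
proof -
  obtain l where l: "l \<noteq> 0" "scal l * v \<in> poles"
    using pole_exists[OF v] .
  define w where "w = scal l * v"
  have "Cent w = Cent v"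
  proof -
    have "conjm y w = w \<longleftrightarrow> conjm y v = v" for y
      using scal_cancel[OF l(1), of "conjm y v" v] by (auto simp: w_def conjm_scal)
    then show ?thesis
      by (auto simp: Cent_iff)
  qed
  then have le: "card (orb w) \<le> 2"
    using card_orb_le_2[of w] l n by (simp add: w_def)
  have mem: "{w, conjm x w, conjm (x * x) w} \<subseteq> orb w"
    using orb_self x mult_H[OF x x] unfolding orb_def by blast
  have "conjm (x * x) w = w"
  proof (rule ccontr)
    assume ne: "conjm (x * x) w \<noteq> w"
    have x1: "det x = 1"
      using x det_H by blast
    have "conjm x w \<noteq> w"
      using ne by (metis conjm_mult)
    moreover have "conjm (x * x) w \<noteq> conjm x w"
      using \<open>conjm x w \<noteq> w\<close> x1 conjm_adj_conjm[OF x1] by (metis conjm_mult)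
    ultimately have "card {w, conjm x w, conjm (x * x) w} = 3"
      using ne by auto
    then show False
      using card_mono[OF _ mem] le by simp
  qed
  then have "x * x \<in> Cent v"
    using x \<open>Cent w = Cent v\<close> by (auto simp: Cent_iff)
  then show ?thesis
    by (simp add: Cent_def)
qed

end

section \<open>Subgroups with a unipotent element\<close>

context sl2_subgroup
begin

text \<open>Bruhat decomposition: over a prime field one nontrivial upper unipotent yields all of
  them, \<open>h\<close> yields the lower ones, and together they generate SL(2, F).\<close>

lemma full_if_upper_unipotent:
  assumes prime_field: "\<And>t::'a. \<exists>n. t = of_nat n"
    and b: "M2 1 b 0 1 \<in> H" "b \<noteq> 0" and h: "h \<in> H" "e21 h \<noteq> 0" and x: "det x = 1"
  shows "x \<in> H"
proof -
  have multiple: "M2 1 (of_nat n * b) 0 1 \<in> H" for n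
  proof (induction n)
    case 0
    then show ?case
      using one_H by (simp add: one_m2_def)
  next
    case (Suc n)
    have "M2 1 (of_nat (Suc n) * b) 0 1 = M2 1 (of_nat n * b) 0 1 * M2 1 b 0 1"
      by (simp add: times_m2_def algebra_simps)
    then show ?case
      using Suc b(1) by simp
  qed
  have U: "M2 1 t 0 1 \<in> H" for t
  proof -
    obtain n where "t / b = of_nat n"
      using prime_field by blast
    then have "t = of_nat n * b"
      using b(2) by (simp add: divide_eq_eq)
    then show ?thesis
      using multiple by simp
  qed
  obtain a' b' c d' where h': "h = M2 a' b' c d'" by (cases h)
  have c: "c \<noteq> 0"
    using h h' by simp
  have "a' * d' - b' * c = 1"
    using det_H[OF h(1)] by (simp add: h' det_def)
  then have b': "b' = (a' * d' - 1) / c"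
    using c by (simp add: eq_divide_eq algebra_simps)
  \<comment> \<open>Upper unipotents on both sides clear the diagonal of \<open>h\<close>. The
    resulting Weyl element conjugates upper unipotents to lower ones.\<close>
  have "M2 1 (- a' / c) 0 1 * h * M2 1 (- d' / c) 0 1 = M2 0 (- 1 / c) c 0"
    using c by (simp add: h' b' times_m2_def diff_divide_distrib)
  then have w: "M2 0 (- 1 / c) c 0 \<in> H"
    using U h(1) mult_H by metis
  have L: "M2 1 0 t 1 \<in> H" for t
  proof -
    have "M2 0 (- 1 / c) c 0 * M2 1 (- t / c ^ 2) 0 1 * adj (M2 0 (- 1 / c) c 0) = M2 1 0 t 1"
      using c by (simp add: adj_def times_m2_def power2_eq_square)
    then show ?thesis
      using U w mult_H adj_H by metis
  qed
  have big_cell: "y \<in> H" if y: "det y = 1" "e21 y \<noteq> 0" for y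
  proof -
    obtain a1 b1 c1 d1 where y': "y = M2 a1 b1 c1 d1" by (cases y)
    have c1: "c1 \<noteq> 0"
      using y y' by simp
    have "a1 * d1 - b1 * c1 = 1"
      using y(1) by (simp add: y' det_def)
    then have b1: "b1 = (a1 * d1 - 1) / c1"
      using c1 by (simp add: eq_divide_eq algebra_simps)
    have "M2 1 ((a1 - 1) / c1) 0 1 * M2 1 0 c1 1 * M2 1 ((d1 - 1) / c1) 0 1 = y"
      using c1 by (simp add: y' b1 times_m2_def field_simps)
    then show ?thesis
      using U L mult_H by metis
  qed
  show ?thesis
  proof (cases "e21 x = 0")
    case True
    \<comment> \<open>Here \<open>e11 x\<close> is nonzero, and adding the first row to the second
      brings it to the lower left corner.\<close>
    then have "e21 (M2 1 0 1 1 * x) \<noteq> 0"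
      using x by (auto simp: times_m2_def det_def)
    moreover have "det (M2 1 0 1 1 * x) = 1"
      unfolding det_mult x by (simp add: det_def)
    ultimately have "M2 1 0 1 1 * x \<in> H"
      by (rule big_cell[rotated])
    moreover have "x = M2 1 0 (- 1) 1 * (M2 1 0 1 1 * x)"
      by (simp add: times_m2_def m2_eq_iff)
    ultimately show ?thesis
      using L mult_H by metis
  qed (use big_cell x in blast)
qed

text \<open>Two elements of a Borel subgroup cannot anticommute: their diagonal entries multiply.\<close>

lemma full_if_unipotent:
  assumes two: "(2::'a) \<noteq> 0" and prime_field: "\<And>t::'a. \<exists>n. t = of_nat n"
    and x: "x \<in> H" "x \<noteq> 1" "tr x = 2" and yz: "y \<in> H" "z \<in> H" "y * z = - (z * y)"
    and u: "det u = 1"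
  shows "u \<in> H"
proof -
  have det_x: "det x = 1"
    using x det_H by blast
  obtain g b where g: "det g = 1" and b: "b \<noteq> 0" "conjm (adj g) x = M2 1 b 0 1"
  proof -
    obtain a b c d where x': "x = M2 a b c d" by (cases x)
    have d: "d = 2 - a"
      using x(3) by (simp add: x' tr_def algebra_simps)
    have bc: "a * d - b * c = 1"
      using det_x by (simp add: x' det_def)
    show thesis
    proof (cases "c = 0")
      case True
      have "(a - 1) ^ 2 = 0"
        using bc by (simp add: True d power2_eq_square algebra_simps)
      then have "a = 1"
        by simp
      then have x1: "x = M2 1 b 0 1"
        by (simp add: x' d True)
      then have "b \<noteq> 0"
        using x(2) by (auto simp: one_m2_def)
      moreover have "adj (1 :: 'a m2) = 1"
        by (simp add: adj_def one_m2_def)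
      ultimately show thesis
        by (intro that[of 1 b]) (simp_all add: x1)
    next
      case False
      have b: "b = (a * d - 1) / c"
        using bc False by (simp add: eq_divide_eq algebra_simps)
      \<comment> \<open>The first column is the image of the first basis vector under
        \<open>x - 1\<close>; it is fixed by \<open>x\<close> because \<open>x - 1\<close> squares
        to zero. The second is the multiple of the first basis vector that gives determinant
        one.\<close>
      define g where "g = M2 (a - 1) (- 1 / c) c 0"
      have "adj g * x * g = M2 1 (- 1 / c) 0 1"
        using False by (simp add: g_def adj_def x' b d times_m2_def field_simps)
      then show thesis
        using False by (intro that[of g "- 1 / c"]) (simp_all add: g_def det_def conjm_def)
    qed
  qed
  \<comment> \<open>Conjugating \<open>H\<close> by \<open>g\<close> turns \<open>x\<close> into an
    upper unipotent.\<close>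
  define H' where "H' = {h. conjm g h \<in> H}"
  have conjm_times: "conjm g (h * k) = conjm g h * conjm g k" for h k
    using g by (simp add: conjm_def mult.assoc)
  have conjm_adj: "conjm g (adj h) = adj (conjm g h)" for h
    by (simp add: conjm_def adj_mult mult.assoc)
  interpret H': sl2_subgroup H'
  proof
    show "det h = 1" if "h \<in> H'" for h
      using that det_H[of "conjm g h"] g by (simp add: H'_def)
    show "1 \<in> H'"
      using g by (simp add: H'_def conjm_def)
  qed (simp_all add: H'_def conjm_times conjm_adj)
  have H'_iff: "conjm (adj g) h \<in> H' \<longleftrightarrow> h \<in> H" for h
    by (simp add: H'_def g)
  define y' z' where "y' = conjm (adj g) y" and "z' = conjm (adj g) z"
  have mem: "y' \<in> H'" "z' \<in> H'"
    using yz by (simp_all add: y'_def z'_def H'_iff)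
  have "adj g * (y * z) * g = - (adj g * (z * y) * g)"
    by (simp add: yz(3))
  then have anti: "y' * z' = - (z' * y')"
    using g by (simp add: y'_def z'_def conjm_def mult.assoc)
  have "e21 y' \<noteq> 0 \<or> e21 z' \<noteq> 0"
  proof (rule ccontr)
    assume "\<not> (e21 y' \<noteq> 0 \<or> e21 z' \<noteq> 0)"
    then have 0: "e21 y' = 0" "e21 z' = 0"
      by auto
    have "e11 (y' * z') = e11 (- (z' * y'))"
      using anti by simp
    then have "2 * (e11 y' * e11 z') = 0"
      using 0 by (simp add: times_m2_def uminus_m2_def)
    then show False
      using two H'.det_H[OF mem(1)] H'.det_H[OF mem(2)] 0 by (auto simp: det_def)
  qed
  moreover have "M2 1 b 0 1 \<in> H'"
    using x(1) by (simp flip: b(2) add: H'_iff)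
  moreover have "det (conjm (adj g) u) = 1"
    using g u by simp
  ultimately have "conjm (adj g) u \<in> H'"
    using H'.full_if_upper_unipotent[OF prime_field] b(1) mem by metis
  then show ?thesis
    by (simp add: H'_iff)
qed

end

section \<open>Stabilisers\<close>

definition conj_stabiliser :: "'a::comm_ring_1 m2 set \<Rightarrow> 'a m2 set" where
  "conj_stabiliser Q = {x. det x = 1 \<and> (\<forall>q \<in> Q. conjm x q \<in> Q)}"

text \<open>For inverses: an injective map of a finite set into itself is onto.\<close>

lemma sl2_subgroup_conj_stabiliser:
  fixes Q :: "'a::{field,finite} m2 set"
  shows "sl2_subgroup (conj_stabiliser Q)"
proof
  fix x assume "x \<in> conj_stabiliser Q"
  then have x: "det x = 1" "conjm x ` Q \<subseteq> Q"
    by (auto simp: conj_stabiliser_def)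
  have "inj_on (conjm x) Q"
    by (rule inj_on_inverseI[of _ "conjm (adj x)"]) (simp add: x)
  then have "conjm x ` Q = Q"
    using x(2) by (intro endo_inj_surj) auto
  then have "conjm (adj x) q \<in> Q" if "q \<in> Q" for q
    using that conjm_adj_conjm[OF x(1)] by (metis imageE)
  then show "adj x \<in> conj_stabiliser Q"
    by (simp add: conj_stabiliser_def x)
qed (auto simp: conj_stabiliser_def conjm_mult)

text \<open>Conjugating \<open>q\<close> by the upper unipotent with entry \<open>t\<close> adds
  \<open>t * e21 q\<close> to the upper left entry, so \<open>q\<close> has at least
  \<open>CARD('a)\<close> conjugates.\<close>

lemma conj_stabiliser_proper:
  fixes Q :: "'a::{field,finite} m2 set"
  assumes q: "q \<in> Q" "e21 q \<noteq> 0" and card: "card Q < CARD('a)"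
  shows "\<exists>x. det x = 1 \<and> x \<notin> conj_stabiliser Q"
proof (rule ccontr)
  assume neg: "\<not> (\<exists>x. det x = 1 \<and> x \<notin> conj_stabiliser Q)"
  define f where "f t = conjm (M2 1 t 0 1) q" for t
  have "f t \<in> Q" for t
    using neg q(1) by (auto simp: f_def conj_stabiliser_def det_def)
  moreover have "inj f"
  proof (rule injI)
    fix t t' assume "f t = f t'"
    then have "e11 (f t) = e11 (f t')"
      by simp
    then show "t = t'"
      using q(2) by (simp add: f_def conjm_def adj_def times_m2_def)
  qed
  ultimately have "CARD('a) \<le> card Q"
    by (intro card_inj_on_le[of f]) auto
  then show False
    using card by simp
qed

text \<open>Both signs are included because a rotation may reverse an axis.\<close>

definition pm :: "'a::comm_ring_1 m2 set \<Rightarrow> 'a m2 set" where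
  "pm S = S \<union> uminus ` S"

lemma card_pm: "finite S \<Longrightarrow> card (pm S) \<le> 2 * card S"
  unfolding pm_def using card_Un_le[of S "uminus ` S"] card_image_le[of S uminus] by linarith

lemma pm_minus: "x \<in> pm S \<Longrightarrow> - x \<in> pm S"
  by (auto simp: pm_def)

lemma conj_stabiliser_pmI:
  assumes "det x = 1" "\<And>q. q \<in> S \<Longrightarrow> \<exists>q' \<in> pm S. x * q = q' * x"
  shows "x \<in> conj_stabiliser (pm S)"
proof -
  have S: "conjm x q \<in> pm S" if "q \<in> S" for q
    using assms(2)[OF that] conjm_eq_iff[OF assms(1)] by metis
  have "conjm x (- q) = - conjm x q" for q
    by (simp add: conjm_def)
  then have "conjm x q \<in> pm S" if "q \<in> pm S" for q
    using that S pm_minus[of _ S] unfolding pm_def[of S] by force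
  then show ?thesis
    using assms(1) by (simp add: conj_stabiliser_def)
qed

lemma pm_stabiliser_proper:
  fixes S :: "'a::{field,finite} m2 set"
  assumes "q \<in> S" "e21 q \<noteq> 0" "finite S" "2 * card S < CARD('a)"
  shows "\<exists>x. det x = 1 \<and> x \<notin> conj_stabiliser (pm S)"
  using assms card_pm[of S] by (intro conj_stabiliser_proper[of q]) (auto simp: pm_def)

section \<open>Two octahedral groups sharing a dihedral subgroup of order six\<close>

text \<open>The primes 2 and 3 occur in denominators; 2, 5, 7 and 11 are the prime factors met in
  the first five powers of \<open>gen1 * gen2\<close>. The bound six is the number of signed axes of
  a cube.\<close>

locale octahedral =
  fixes i s :: "'a::{field,finite}"
  assumes i_sq: "i * i = - 1" and s_sq: "s * s = 2"
    and nonzero: "(2::'a) \<noteq> 0" "(3::'a) \<noteq> 0" "(5::'a) \<noteq> 0" "(7::'a) \<noteq> 0" "(11::'a) \<noteq> 0"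
    and prime_field: "\<And>t::'a. \<exists>n. t = of_nat n"
    and large: "6 < CARD('a)"
begin

text \<open>In terms of the quaternion units \<open>qI\<close>, \<open>qJ\<close>, \<open>qK\<close>, the generators are
  \<open>(I + J + 4K) / 3\<surd>2\<close>, \<open>(I + J) / \<surd>2\<close> and \<open>(1 + I + J + K) / 2\<close>, and \<open>twist\<close>
  is \<open>(I - J) / \<surd>2\<close>. The last two generators span the binary octahedral group of
  \<open>{I, J, K}\<close>; the first and the last one that of its image under the half-turn about
  \<open>I + J + K\<close>.\<close>

definition qI :: "'a m2" where "qI = M2 i 0 0 (- i)"
definition qJ :: "'a m2" where "qJ = M2 0 1 (- 1) 0"
definition qK :: "'a m2" where "qK = M2 0 i i 0"

definition gen1 :: "'a m2" where
  "gen1 = scal (1 / (3 * s)) * M2 i (1 + 4 * i) (4 * i - 1) (- i)"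
definition gen2 :: "'a m2" where
  "gen2 = scal (1 / s) * M2 i 1 (- 1) (- i)"
definition gen3 :: "'a m2" where
  "gen3 = scal (1 / 2) * M2 (1 + i) (1 + i) (i - 1) (1 - i)"
definition twist :: "'a m2" where
  "twist = scal (1 / s) * M2 i (- 1) 1 (- i)"

lemma i_mult [simp]: "i * i = - 1" "i * (i * x) = - x"
  by (simp_all add: i_sq flip: mult.assoc)

lemma s_nonzero: "s \<noteq> 0"
  using s_sq nonzero(1) by auto

lemma minus_one_neq_one: "(- 1 :: 'a) \<noteq> 1"
proof
  assume "(- 1 :: 'a) = 1"
  then have "(1::'a) + 1 = 0" by (metis add.right_inverse)
  then show False using nonzero(1) by simp
qed

lemma i_neq_one: "i \<noteq> 1" "i \<noteq> 0"
proof -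
  show "i \<noteq> 1"
    using i_sq minus_one_neq_one by (metis mult_1)
  show "i \<noteq> 0"
    using i_sq by (metis mult_zero_left neg_equal_0_iff_equal one_neq_zero)
qed

lemma det_gens: "det gen1 = 1" "det gen2 = 1" "det gen3 = 1" "det twist = 1"
proof -
  have "(18::'a) = 2 * 3 * 3" "(4::'a) = 2 * 2"
    by simp_all
  then have n: "(18::'a) \<noteq> 0" "(4::'a) \<noteq> 0"
    using nonzero by (simp_all only: mult_eq_0_iff simp_thms)
  have "(1 / (3 * s)) ^ 2 = 1 / (18::'a)" "(1 / s) ^ 2 = 1 / 2" "(1 / 2) ^ 2 = 1 / (4::'a)"
    by (simp_all add: power2_eq_square s_sq mult.left_commute[of s] mult.assoc)
  moreover have "det (M2 i (1 + 4 * i) (4 * i - 1) (- i)) = 18" "det (M2 i 1 (- 1) (- i)) = 2"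
    "det (M2 (1 + i) (1 + i) (i - 1) (1 - i)) = 4" "det (M2 i (- 1) 1 (- i)) = 2"
    by (simp_all add: det_def algebra_simps)
  ultimately show "det gen1 = 1" "det gen2 = 1" "det gen3 = 1" "det twist = 1"
    using nonzero(1) n by (simp_all add: gen1_def gen2_def gen3_def twist_def)
qed

lemma scaled_stabilises:
  assumes "det (scal k * x) = 1" "\<And>q. q \<in> S \<Longrightarrow> \<exists>q' \<in> pm S. x * q = q' * x"
  shows "scal k * x \<in> conj_stabiliser (pm S)"
proof (rule conj_stabiliser_pmI[OF assms(1)])
  fix q assume "q \<in> S"
  then obtain q' where "q' \<in> pm S" "x * q = q' * x"
    using assms(2) by blast
  moreover from this have "scal k * x * q = q' * (scal k * x)"
    by (blast intro: scal_intertwine)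
  ultimately show "\<exists>q' \<in> pm S. scal k * x * q = q' * (scal k * x)"
    by blast
qed

text \<open>\<open>r1\<close>, \<open>r2\<close>, \<open>r3\<close> are three times the images of
  \<open>qI\<close>, \<open>qJ\<close>, \<open>qK\<close> under the half-turn about
  \<open>I + J + K\<close>: the axes of the second cube.\<close>

definition r1 :: "'a m2" where "r1 = M2 (- i) (2 + 2 * i) (2 * i - 2) i"
definition r2 :: "'a m2" where "r2 = M2 (2 * i) (2 * i - 1) (2 * i + 1) (- 2 * i)"
definition r3 :: "'a m2" where "r3 = M2 (2 * i) (2 - i) (- 2 - i) (- 2 * i)"
text \<open>This is \<open>twist\<close> without its scalar factor. Preserving it up to sign means
  centralising \<open>twist\<close> modulo sign.\<close>

definition w0 :: "'a m2" where "w0 = M2 i (- 1) 1 (- i)"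

lemmas intertwine_simps = qI_def qJ_def qK_def r1_def r2_def r3_def w0_def
  times_m2_def uminus_m2_def algebra_simps

text \<open>Rotations of the cube permute its axes up to sign; the normalising scalars are left
  out.\<close>

lemma intertwine1:
  "M2 i 1 (- 1) (- i) * qI = qJ * M2 i 1 (- 1) (- i)" "M2 i 1 (- 1) (- i) * qJ = qI * M2 i 1 (- 1) (- i)" "M2 i 1 (- 1) (- i) * qK = - qK * M2 i 1 (- 1) (- i)"
  "M2 (1 + i) (1 + i) (i - 1) (1 - i) * qI = qJ * M2 (1 + i) (1 + i) (i - 1) (1 - i)" "M2 (1 + i) (1 + i) (i - 1) (1 - i) * qJ = qK * M2 (1 + i) (1 + i) (i - 1) (1 - i)" "M2 (1 + i) (1 + i) (i - 1) (1 - i) * qK = qI * M2 (1 + i) (1 + i) (i - 1) (1 - i)"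
  "M2 i (- 1) 1 (- i) * qI = - qJ * M2 i (- 1) 1 (- i)" "M2 i (- 1) 1 (- i) * qJ = - qI * M2 i (- 1) 1 (- i)" "M2 i (- 1) 1 (- i) * qK = - qK * M2 i (- 1) 1 (- i)"
  by (simp_all add: intertwine_simps)

lemma intertwine2:
  "M2 i (1 + 4 * i) (4 * i - 1) (- i) * r1 = r2 * M2 i (1 + 4 * i) (4 * i - 1) (- i)" "M2 i (1 + 4 * i) (4 * i - 1) (- i) * r2 = r1 * M2 i (1 + 4 * i) (4 * i - 1) (- i)" "M2 i (1 + 4 * i) (4 * i - 1) (- i) * r3 = - r3 * M2 i (1 + 4 * i) (4 * i - 1) (- i)"
  "M2 (1 + i) (1 + i) (i - 1) (1 - i) * r1 = r2 * M2 (1 + i) (1 + i) (i - 1) (1 - i)" "M2 (1 + i) (1 + i) (i - 1) (1 - i) * r2 = r3 * M2 (1 + i) (1 + i) (i - 1) (1 - i)" "M2 (1 + i) (1 + i) (i - 1) (1 - i) * r3 = r1 * M2 (1 + i) (1 + i) (i - 1) (1 - i)"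
  "M2 i (- 1) 1 (- i) * r1 = - r2 * M2 i (- 1) 1 (- i)" "M2 i (- 1) 1 (- i) * r2 = - r1 * M2 i (- 1) 1 (- i)" "M2 i (- 1) 1 (- i) * r3 = - r3 * M2 i (- 1) 1 (- i)"
  by (simp_all add: intertwine_simps)

lemma intertwine3:
  "M2 i (1 + 4 * i) (4 * i - 1) (- i) * w0 = - w0 * M2 i (1 + 4 * i) (4 * i - 1) (- i)"
  "M2 i 1 (- 1) (- i) * w0 = - w0 * M2 i 1 (- 1) (- i)"
  "M2 i (- 1) 1 (- i) * w0 = w0 * M2 i (- 1) 1 (- i)"
  by (simp_all add: intertwine_simps)

lemma stabilises1:
  "gen2 \<in> conj_stabiliser (pm {qI, qJ, qK})" "gen3 \<in> conj_stabiliser (pm {qI, qJ, qK})" "twist \<in> conj_stabiliser (pm {qI, qJ, qK})"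
proof -
  show "gen2 \<in> conj_stabiliser (pm {qI, qJ, qK})"
    using det_gens(2) intertwine1 unfolding gen2_def
    by (intro scaled_stabilises) (auto simp: pm_def)
  show "gen3 \<in> conj_stabiliser (pm {qI, qJ, qK})"
    using det_gens(3) intertwine1 unfolding gen3_def
    by (intro scaled_stabilises) (auto simp: pm_def)
  show "twist \<in> conj_stabiliser (pm {qI, qJ, qK})"
    using det_gens(4) intertwine1 unfolding twist_def
    by (intro scaled_stabilises) (auto simp: pm_def)
qed

lemma stabilises2:
  "gen1 \<in> conj_stabiliser (pm {r1, r2, r3})" "gen3 \<in> conj_stabiliser (pm {r1, r2, r3})" "twist \<in> conj_stabiliser (pm {r1, r2, r3})"
proof -
  show "gen1 \<in> conj_stabiliser (pm {r1, r2, r3})"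
    using det_gens(1) intertwine2 unfolding gen1_def
    by (intro scaled_stabilises) (auto simp: pm_def)
  show "gen3 \<in> conj_stabiliser (pm {r1, r2, r3})"
    using det_gens(3) intertwine2 unfolding gen3_def
    by (intro scaled_stabilises) (auto simp: pm_def)
  show "twist \<in> conj_stabiliser (pm {r1, r2, r3})"
    using det_gens(4) intertwine2 unfolding twist_def
    by (intro scaled_stabilises) (auto simp: pm_def)
qed

lemma stabilises3:
  "gen1 \<in> conj_stabiliser (pm {w0})" "gen2 \<in> conj_stabiliser (pm {w0})" "twist \<in> conj_stabiliser (pm {w0})"
proof -
  show "gen1 \<in> conj_stabiliser (pm {w0})"
    using det_gens(1) intertwine3 unfolding gen1_def
    by (intro scaled_stabilises) (auto simp: pm_def)
  show "gen2 \<in> conj_stabiliser (pm {w0})"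
    using det_gens(2) intertwine3 unfolding gen2_def
    by (intro scaled_stabilises) (auto simp: pm_def)
  show "twist \<in> conj_stabiliser (pm {w0})"
    using det_gens(4) intertwine3 unfolding twist_def
    by (intro scaled_stabilises) (auto simp: pm_def)
qed

lemma twist_neq: "twist \<noteq> 1" "twist \<noteq> - 1"
  using s_nonzero by (auto simp: twist_def scal_def times_m2_def one_m2_def uminus_m2_def)

lemma stabilisers_proper:
  "\<exists>x. det x = 1 \<and> x \<notin> conj_stabiliser (pm {qI, qJ, qK})"
  "\<exists>x. det x = 1 \<and> x \<notin> conj_stabiliser (pm {r1, r2, r3})"
  "\<exists>x. det x = 1 \<and> x \<notin> conj_stabiliser (pm {w0})"
proof -
  have card: "2 * card {x, y, z :: 'a m2} < CARD('a)" for x y z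
    using large card_insert_le_m1[of 3 "{y, z}" x] card_insert_le_m1[of 2 "{z}" y] by simp
  show "\<exists>x. det x = 1 \<and> x \<notin> conj_stabiliser (pm {qI, qJ, qK})"
    using card by (intro pm_stabiliser_proper[of qJ]) (simp_all add: qJ_def)
  have "2 * i - 2 = 2 * (i - 1)"
    by (simp add: algebra_simps)
  then have "2 * i - 2 \<noteq> 0"
    using nonzero(1) i_neq_one by simp
  then show "\<exists>x. det x = 1 \<and> x \<notin> conj_stabiliser (pm {r1, r2, r3})"
    using card by (intro pm_stabiliser_proper[of r1]) (simp_all add: r1_def)
  show "\<exists>x. det x = 1 \<and> x \<notin> conj_stabiliser (pm {w0})"
    using large by (intro pm_stabiliser_proper[of w0]) (simp_all add: w0_def)
qed

section \<open>The rotation \<open>gen1 * gen2\<close> and its powers\<close>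

text \<open>\<open>lin u w\<close> is the quaternion \<open>u + w (J - I)\<close>.\<close>

definition lin :: "'a \<Rightarrow> 'a \<Rightarrow> 'a m2" where
  "lin u w = M2 (u - w * i) w (- w) (u + w * i)"

text \<open>The square of \<open>J - I\<close> is \<open>- 2\<close>, so these matrices multiply
  like \<open>u + w * sqrt (- 2)\<close> and commute.\<close>

lemma lin_mult [simp]: "lin u w * lin u' w' = lin (u * u' - 2 * (w * w')) (u * w' + w * u')"
  by (simp add: lin_def times_m2_def algebra_simps)

lemma gen12: "gen1 * gen2 = scal (1 / 3) * lin (- 1) 2"
proof -
  have "M2 i (1 + 4 * i) (4 * i - 1) (- i) * M2 i 1 (- 1) (- i) = scal 2 * lin (- 1) 2"
    by (simp add: times_m2_def lin_def scal_def algebra_simps)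
  then have "gen1 * gen2 = scal (1 / (3 * s) * (1 / s)) * (scal 2 * lin (- 1) 2)"
    unfolding gen1_def gen2_def scal_mult_mult by simp
  then have "gen1 * gen2 = scal (1 / (3 * s) * (1 / s) * 2) * lin (- 1) 2"
    by (simp only: scal_mult flip: mult.assoc)
  moreover have "1 / (3 * s) * (1 / s) * 2 = (1 / 3 :: 'a)"
  proof -
    have "1 / (3 * s) * (1 / s) * 2 = 2 / (3 * (s * s))"
      by (simp add: mult.assoc)
    then show ?thesis
      using nonzero unfolding s_sq by (simp only: nonzero_divide_mult_cancel_right not_False_eq_True)
  qed
  ultimately show ?thesis
    by (simp only:)
qed

text \<open>Up to powers of 1/3 the coefficients of \<open>J - I\<close> in the first five powers
  are 2, -4, -10, 56 and -22, all nonzero in the field.\<close>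

lemma gen12_power_neq:
  assumes "0 < k" "k < 6"
  shows "(gen1 * gen2) ^ k \<noteq> 1" "(gen1 * gen2) ^ k \<noteq> - 1"
proof -
  have pow: "(gen1 * gen2) ^ k = scal ((1 / 3) ^ k) * lin (- 1) 2 ^ k" for k
    by (induction k) (simp_all add: gen12 scal_mult_mult)
  have "k \<in> {1, 2, 3, 4, 5}"
    using assms by auto
  then have "\<exists>u w. lin (- 1) 2 ^ k = lin u w \<and> w \<noteq> 0"
  proof (elim insertE)
    have "(4::'a) = 2 * 2" "(10::'a) = 2 * 5" "(56::'a) = 2 * 2 * 2 * 7" "(22::'a) = 2 * 11"
      by simp_all
    then have nz: "(4::'a) \<noteq> 0" "(10::'a) \<noteq> 0" "(56::'a) \<noteq> 0" "(22::'a) \<noteq> 0"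
      using nonzero by (simp_all only: mult_eq_0_iff simp_thms)
    have witness: ?thesis if "lin (- 1) 2 ^ k = lin u w" "w \<noteq> 0" for u w
      using that by blast
    have 4: "lin (- 1) 2 ^ 4 = lin 17 56"
      by (simp add: eval_nat_numeral)
    have "lin (- 1) 2 ^ 5 = lin (- 1) 2 * lin (- 1) 2 ^ 4"
      by (simp flip: power_Suc)
    then have 5: "lin (- 1) 2 ^ 5 = lin (- 241) (- 22)"
      unfolding 4 by simp
    show ?thesis if "k = 1"
      using nonzero(1) that by (intro witness[of "- 1" 2]) auto
    show ?thesis if "k = 2"
      using nz that by (intro witness[of "- 7" "- 4"]) (auto simp: power2_eq_square)
    show ?thesis if "k = 3"
      using nz that by (intro witness[of 23 "- 10"]) (auto simp: power3_eq_cube)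
    show ?thesis if "k = 4"
      using nz that 4 by (intro witness[of 17 56]) auto
    show ?thesis if "k = 5"
      using nz that 5 by (intro witness[of "- 241" "- 22"]) auto
  qed simp
  then obtain u w where uw: "(gen1 * gen2) ^ k = scal ((1 / 3) ^ k) * lin u w" "w \<noteq> 0"
    unfolding pow by metis
  have "e12 ((gen1 * gen2) ^ k) \<noteq> 0"
    unfolding uw(1) using nonzero(2) uw(2) by (simp add: scal_def lin_def times_m2_def)
  then show "(gen1 * gen2) ^ k \<noteq> 1" "(gen1 * gen2) ^ k \<noteq> - 1"
    by (auto simp: one_m2_def uminus_m2_def)
qed

lemma full_if_generators:
  assumes "sl2_subgroup H" and gens: "gen1 \<in> H" "gen2 \<in> H" "gen3 \<in> H" and u: "det u = 1"
  shows "u \<in> H"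
proof -
  interpret sl2_subgroup H by fact
  \<comment> \<open>\<open>gen2 * gen3\<close> is \<open>(I - 1) / s\<close>, a quarter-turn about
    \<open>I\<close>, and its square is \<open>- qI\<close>. This supplies \<open>- 1\<close> and,
    with \<open>gen3\<close>, the anticommuting pair.\<close>
  have "M2 i 1 (- 1) (- i) * M2 (1 + i) (1 + i) (i - 1) (1 - i) = scal 2 * M2 (i - 1) 0 0 (- i - 1)"
    by (simp add: scal_def times_m2_def algebra_simps)
  then have "gen2 * gen3 = scal (1 / s) * M2 (i - 1) 0 0 (- i - 1)"
    using nonzero(1) unfolding gen2_def gen3_def scal_mult_mult
    by (simp add: scal_mult flip: mult.assoc)
  moreover have "M2 (i - 1) 0 0 (- i - 1) * M2 (i - 1) 0 0 (- i - 1) = scal (- 2) * qI"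
    by (simp add: scal_def qI_def times_m2_def algebra_simps)
  ultimately have "gen2 * gen3 * (gen2 * gen3) = scal (1 / s * (1 / s)) * (scal (- 2) * qI)"
    by (simp only: scal_mult_mult)
  also have "\<dots> = - qI"
    using nonzero(1) by (simp add: s_sq scal_mult scal_minus flip: mult.assoc)
  finally have "gen2 * gen3 * (gen2 * gen3) = - qI" .
  then have nI: "- qI \<in> H"
    using gens mult_H by metis
  have "- qI * - qI = - 1"
    by (simp add: qI_def times_m2_def one_m2_def uminus_m2_def)
  then have minus_one: "- 1 \<in> H"
    using nI mult_H by metis
  have "gen3 * qI = qJ * gen3"
    unfolding gen3_def by (rule scal_intertwine) (rule intertwine1)
  then have "conjm gen3 (- qI) = - qJ"
    using det_gens(3) by (simp add: conjm_eq_iff)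
  then have nJ: "- qJ \<in> H"
    using nI gens mult_H adj_H unfolding conjm_def by metis
  have anti: "- qI * - qJ = - (- qJ * - qI)"
    by (simp add: qI_def qJ_def times_m2_def uminus_m2_def)
  show ?thesis
  proof (cases "\<exists>x \<in> H. x \<noteq> 1 \<and> x \<noteq> - 1 \<and> (tr x) ^ 2 = 4")
    case True
    then obtain x where x: "x \<in> H" "x \<noteq> 1" "x \<noteq> - 1" "(tr x) ^ 2 = 4"
      by blast
    have "(tr x) ^ 2 = 2 ^ 2"
      using x(4) by simp
    then have "tr x = 2 \<or> tr x = - 2"
      by (simp only: power2_eq_iff)
    \<comment> \<open>For trace -2 it is \<open>- x\<close> that is unipotent.\<close>
    then obtain y where "y \<in> H" "y \<noteq> 1" "tr y = 2"
    proof
      assume "tr x = - 2"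
      moreover have "- x \<in> H"
        using mult_H[OF minus_one x(1)] by simp
      moreover have "- x \<noteq> 1"
        using x(3) by (metis minus_minus)
      ultimately show thesis
        using that[of "- x"] by auto
    qed (use that x in blast)
    then show ?thesis
      using full_if_unipotent[OF nonzero(1) prime_field _ _ _ nI nJ anti u] by blast
  next
    case False
    interpret sl2_semisimple H
      by standard (use minus_one nonzero(1) False in auto)
    \<comment> \<open>\<open>t\<close> is \<open>J - I\<close>, which spans the axis of
      \<open>y\<close>.\<close>
    define y t where "y = gen1 * gen2" and "t = lin 0 1"
    have y: "y \<in> H"
      using gens by (simp add: y_def)
    have "y * t = t * y"
      unfolding y_def t_def gen12 by (rule scal_intertwine) simp
    then have y_pow: "y ^ k \<in> Cent t" for k
      using y by (induction k) (auto simp: Cent_iff conjm_mult det_H conjm_eq_iff)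
    \<comment> \<open>\<open>f\<close> lists the twelve elements \<open>y ^ k\<close> and
      \<open>- (y ^ k)\<close> with \<open>k < 6\<close>, all of which centralise
      \<open>t\<close>.\<close>
    define f where "f = (\<lambda>(k, b). if b then y ^ k else - (y ^ k))"
    have "inj_on f ({..<6} \<times> UNIV)"
    proof -
      have eq: "k = l \<and> b = c" if "f (k, b) = f (l, c)" "k \<le> l" "l < 6" for k l b c
      proof -
        have "det (y ^ k) = 1"
          using y_pow by (auto simp: Cent_def intro: det_H)
        have "y ^ l = y ^ k * y ^ (l - k)"
          using that(2) by (simp flip: power_add)
        moreover have "y ^ l = y ^ k \<or> y ^ l = y ^ k * - 1"
          using that(1) by (auto simp: f_def split: if_splits)
        ultimately have "y ^ (l - k) = 1 \<or> y ^ (l - k) = - 1"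
          using det_one_inverse(4)[OF \<open>det (y ^ k) = 1\<close>] by (metis mult.right_neutral)
        then have "k = l"
          using gen12_power_neq[of "l - k"] that(2,3) by (fastforce simp: y_def)
        moreover have "y ^ k \<noteq> - (y ^ k)"
          using neq_minus \<open>det (y ^ k) = 1\<close> by simp
        ultimately show ?thesis
          using that(1) by (auto simp: f_def split: if_splits)
      qed
      show ?thesis
      proof (rule inj_onI, clarify)
        fix k b l c assume "k < 6" "l < 6" "f (k, b) = f (l, c)"
        then show "k = l \<and> b = c"
          using eq[of k b l c] eq[of l c k b] by (cases "k \<le> l") auto
      qed
    qed
    then have "card (f ` ({..<6} \<times> UNIV)) = 12"
      by (simp add: card_image)
    moreover have "f ` ({..<6} \<times> UNIV) \<subseteq> Cent t"
      using y_pow mult_H[OF minus_one] by (fastforce simp: f_def Cent_def)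
    ultimately have "card (Cent t) \<ge> 12"
      by (metis card_mono finite)
    moreover have "tr t = 0" "det t \<noteq> 0"
      using nonzero(1) by (simp_all add: t_def lin_def tr_def det_def)
    ultimately have comm: "gen3 * gen3 * t = t * (gen3 * gen3)"
      using square_commutes[of t gen3] gens by blast
    \<comment> \<open>\<open>P\<close> is \<open>- 1 + I + J + K\<close>, twice the square of
      \<open>gen3\<close>. It is a rotation about a diagonal perpendicular to \<open>t\<close>, so
      it cannot commute with \<open>t\<close>.\<close>
    define P where "P = M2 (i - 1) (1 + i) (i - 1) (- i - 1)"
    have "M2 (1 + i) (1 + i) (i - 1) (1 - i) * M2 (1 + i) (1 + i) (i - 1) (1 - i) = scal 2 * P"
      by (simp add: scal_def times_m2_def P_def algebra_simps)
    then have "gen3 * gen3 = scal (1 / 2 * (1 / 2)) * (scal 2 * P)"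
      by (simp only: gen3_def scal_mult_mult)
    also have "\<dots> = scal (1 / 2 * (1 / 2 * 2)) * P"
      by (simp only: scal_mult mult.assoc flip: mult.assoc[of "scal _"])
    also have "1 / 2 * (1 / 2 * 2) = (1 / 2 :: 'a)"
      using nonzero(1) by simp
    finally have g3: "gen3 * gen3 = scal (1 / 2) * P" .
    have "scal (1 / 2) * (P * t) = scal (1 / 2) * (t * P)"
      using comm unfolding g3 by (simp add: scal_commute[of t] flip: mult.assoc)
    then have "P * t = t * P"
      by (rule scal_cancel[rotated]) (use nonzero(1) in simp)
    then have "e11 (P * t) = e11 (t * P)"
      by simp
    then have "2 * i = 0"
      by (simp add: P_def t_def lin_def times_m2_def algebra_simps)
    then show ?thesis
      using nonzero(1) i_neq_one by simp
  qed
qed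

end

section \<open>Failure of the replacement property\<close>

text \<open>\<open>K\<close>, \<open>L\<close>, \<open>M\<close> go with the first, second and third
  entry: each contains \<open>x\<close> and the other two entries.\<close>

lemma (in group) replacement_fails:
  assumes gen: "generate G {a, b, c} = carrier G"
    and sub: "subgroup K G" "subgroup L G" "subgroup M G"
    and proper: "K \<noteq> carrier G" "L \<noteq> carrier G" "M \<noteq> carrier G"
    and a: "a \<in> L" "a \<in> M" and b: "b \<in> K" "b \<in> M" and c: "c \<in> K" "c \<in> L"
    and x: "x \<in> K" "x \<in> L" "x \<in> M" "x \<noteq> \<one>"
  shows "irredundant_generating_seq G [a, b, c]" "\<not> replacement_property_for G [a, b, c]"
proof -
  have not_gen: "\<not> generating_seq G s" if "set s \<subseteq> S" "S \<in> {K, L, M}" for s S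
    using that sub proper generate_subgroup_incl[of "set s" S] subgroup.subset[of S G]
    unfolding generating_seq_def by blast
  have "generating_seq G [a, b, c]"
    using gen a b c sub subgroup.mem_carrier by (force simp: generating_seq_def)
  moreover have "\<not> generating_seq G (take j [a, b, c] @ drop (Suc j) [a, b, c])" if "j < 3" for j
  proof -
    have "j = 0 \<or> j = 1 \<or> j = 2"
      using that by linarith
    then consider "j = 0" | "j = 1" | "j = 2"
      by blast
    then show ?thesis
    proof cases
      case 1
      then show ?thesis using b c by (intro not_gen[of _ K]) auto
    next
      case 2
      then show ?thesis using a c by (intro not_gen[of _ L]) auto
    next
      case 3
      then show ?thesis using a b by (intro not_gen[of _ M]) auto
    qed
  qed
  ultimately show "irredundant_generating_seq G [a, b, c]"
    by (simp add: irredundant_generating_seq_def)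
  have "\<not> generating_seq G ([a, b, c][j := x])" if "j < 3" for j
  proof -
    have "j = 0 \<or> j = 1 \<or> j = 2"
      using that by linarith
    then consider "j = 0" | "j = 1" | "j = 2"
      by blast
    then show ?thesis
    proof cases
      case 1
      then show ?thesis using b c x by (intro not_gen[of _ K]) auto
    next
      case 2
      then show ?thesis using a c x by (intro not_gen[of _ L]) auto
    next
      case 3
      then show ?thesis using a b x by (intro not_gen[of _ M]) auto
    qed
  qed
  moreover have "x \<in> carrier G"
    using subgroup.mem_carrier[OF sub(1) x(1)] .
  moreover have "length [a, b, c] = 3"
    by simp
  ultimately show "\<not> replacement_property_for G [a, b, c]"
    unfolding replacement_property_for_def using x(4) by auto
qed

section \<open>Passage from matrices to a quotient by signs\<close>

definition SL_group :: "'a::comm_ring_1 m2 monoid" where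
  "SL_group = \<lparr>carrier = {x. det x = 1}, monoid.mult = (*), one = 1\<rparr>"

lemma group_SL_group: "group SL_group"
proof (rule groupI)
  fix x :: "'a m2" assume "x \<in> carrier SL_group"
  then show "\<exists>y \<in> carrier SL_group. y \<otimes>\<^bsub>SL_group\<^esub> x = \<one>\<^bsub>SL_group\<^esub>"
    by (intro bexI[of _ "adj x"]) (simp_all add: SL_group_def)
qed (auto simp: SL_group_def mult.assoc)

lemma sl2_subgroup_subgroup:
  assumes "sl2_subgroup K"
  shows "subgroup K SL_group"
proof -
  interpret sl2_subgroup K by fact
  interpret S: group "SL_group :: 'a m2 monoid" by (rule group_SL_group)
  have "inv\<^bsub>SL_group\<^esub> x = adj x" if "x \<in> K" for x
    using det_H[OF that] by (intro S.inv_equality) (simp_all add: SL_group_def)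
  then show ?thesis
    by (intro S.subgroupI) (auto simp: SL_group_def det_H intro: one_H)
qed

text \<open>\<open>\<pi>\<close> plays the part of the projection onto PSL(2, p). A stabiliser
  contains \<open>- k\<close> along with \<open>k\<close>, hence the kernel, so proper stabilisers
  have proper images.\<close>

lemma (in octahedral) replacement_property_fails:
  assumes hom: "group_hom (SL_group :: 'a m2 monoid) G \<pi>"
    and surj: "\<pi> ` {x. det x = 1} = carrier G"
    and ker: "\<And>x. det x = 1 \<Longrightarrow> \<pi> x = \<one>\<^bsub>G\<^esub> \<Longrightarrow> x = 1 \<or> x = - 1"
    and max: "max_irredundant_length G = 3"
  shows "\<not> replacement_property G"
proof -
  interpret group_hom "SL_group :: 'a m2 monoid" G \<pi> by fact
  have carrier: "carrier SL_group = {x :: 'a m2. det x = 1}"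
    and mult: "monoid.mult SL_group = ((*) :: 'a m2 \<Rightarrow> _)" and one: "\<one>\<^bsub>SL_group\<^esub> = (1 :: 'a m2)"
    by (simp_all add: SL_group_def)
  have hom_mult: "\<pi> (x * y) = \<pi> x \<otimes>\<^bsub>G\<^esub> \<pi> y" if "det x = 1" "det y = 1" for x y
    using hom_mult[of x y] that by (simp add: carrier mult)
  have img_sub: "subgroup (\<pi> ` conj_stabiliser (pm S)) G" for S
    by (intro subgroup_img_is_subgroup sl2_subgroup_subgroup sl2_subgroup_conj_stabiliser)
  have img_proper: "\<pi> ` conj_stabiliser (pm S) \<noteq> carrier G"
    if ex: "\<exists>x. det x = 1 \<and> x \<notin> conj_stabiliser (pm S)" for S
  proof
    interpret K: sl2_subgroup "conj_stabiliser (pm S)"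
      by (rule sl2_subgroup_conj_stabiliser)
    assume img: "\<pi> ` conj_stabiliser (pm S) = carrier G"
    obtain x where x: "det x = 1" "x \<notin> conj_stabiliser (pm S)"
      using ex by blast
    then have "\<pi> x \<in> \<pi> ` conj_stabiliser (pm S)"
      unfolding img using surj by blast
    then obtain k where k: "k \<in> conj_stabiliser (pm S)" "\<pi> x = \<pi> k"
      by auto
    have det_k: "det k = 1"
      using k K.det_H by blast
    have "\<pi> (adj k * x) = \<pi> (adj k * k)"
      using x det_k by (simp only: hom_mult det_adj k(2))
    also have "\<dots> = \<one>\<^bsub>G\<^esub>"
      using hom_one det_k by (simp add: one)
    finally have "adj k * x = 1 \<or> adj k * x = - 1"
      using x det_k by (intro ker) simp_all
    then have "k * (adj k * x) = k \<or> k * (adj k * x) = - k"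
      by auto
    then have "x = k \<or> x = - k"
      using det_k by simp
    moreover have "- k \<in> conj_stabiliser (pm S)"
      using k by (simp add: conj_stabiliser_def)
    ultimately show False
      using k x by blast
  qed
  have "generate G {\<pi> gen1, \<pi> gen2, \<pi> gen3} = carrier G"
  proof
    have gens: "{\<pi> gen1, \<pi> gen2, \<pi> gen3} \<subseteq> carrier G"
      using det_gens surj by blast
    then show "generate G {\<pi> gen1, \<pi> gen2, \<pi> gen3} \<subseteq> carrier G"
      by (rule H.generate_incl)
    \<comment> \<open>The preimage in SL of the generated subgroup, to which
      \<open>full_if_generators\<close> applies.\<close>
    define H where "H = {x. det x = 1 \<and> \<pi> x \<in> generate G {\<pi> gen1, \<pi> gen2, \<pi> gen3}}"
    have H: "sl2_subgroup H"
    proof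
      show "1 \<in> H"
        using hom_one by (simp add: H_def one generate.one)
      fix x assume "x \<in> H"
      then have x: "det x = 1" "\<pi> x \<in> generate G {\<pi> gen1, \<pi> gen2, \<pi> gen3}"
        by (simp_all add: H_def)
      have "inv\<^bsub>SL_group\<^esub> x = adj x"
        using x by (intro G.inv_equality) (simp_all add: SL_group_def)
      then have "\<pi> (adj x) = inv\<^bsub>G\<^esub> \<pi> x"
        using hom_inv[of x] x by (simp add: carrier)
      then show "adj x \<in> H"
        using x H.generate_m_inv_closed[OF gens] by (simp add: H_def)
    qed (auto simp: H_def hom_mult intro: generate.eng)
    have "gen1 \<in> H" "gen2 \<in> H" "gen3 \<in> H"
      using det_gens by (auto simp: H_def intro: generate.incl)
    then have "x \<in> H" if "det x = 1" for x
      using full_if_generators[OF H] that by blast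
    then have "\<pi> ` {x. det x = 1} \<subseteq> generate G {\<pi> gen1, \<pi> gen2, \<pi> gen3}"
      by (auto simp: H_def)
    then show "carrier G \<subseteq> generate G {\<pi> gen1, \<pi> gen2, \<pi> gen3}"
      by (simp only: surj)
  qed
  moreover have "\<pi> twist \<noteq> \<one>\<^bsub>G\<^esub>"
    using ker twist_neq det_gens by blast
  ultimately have
    "irredundant_generating_seq G [\<pi> gen1, \<pi> gen2, \<pi> gen3]"
    "\<not> replacement_property_for G [\<pi> gen1, \<pi> gen2, \<pi> gen3]"
    using H.replacement_fails[OF _ img_sub img_sub img_sub img_proper[OF stabilisers_proper(1)]
        img_proper[OF stabilisers_proper(2)] img_proper[OF stabilisers_proper(3)],
        of "\<pi> gen1" "\<pi> gen2" "\<pi> gen3" "\<pi> twist"]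
      stabilises1 stabilises2 stabilises3 by (simp_all add: imageI)
  then show ?thesis
    using max by (auto simp: replacement_property_def)
qed

section \<open>The prime field\<close>

lemma to_int_bounds: "to_int_mod_ring (x :: 'a::finite mod_ring) \<in> {0..<int CARD('a)}"
  by (rule subsetD[OF equalityD1[OF range_to_int_mod_ring]]) simp

lemma to_int_add: "to_int_mod_ring (x + y :: 'a::finite mod_ring) =
    (to_int_mod_ring x + to_int_mod_ring y) mod int CARD('a)"
  and to_int_mult: "to_int_mod_ring (x * y) = (to_int_mod_ring x * to_int_mod_ring y) mod int CARD('a)"
  and to_int_diff: "to_int_mod_ring (x - y) = (to_int_mod_ring x - to_int_mod_ring y) mod int CARD('a)"
  by (transfer, simp)+

text \<open>Carries matrices over the type \<open>mod_ring\<close> to integer tuples over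
  \<open>residue_ring\<close>; on determinant one it is an isomorphism onto
  \<open>SL2\<close>.\<close>

definition to_tuple :: "'a::finite mod_ring m2 \<Rightarrow> int mat2" where
  "to_tuple x = (to_int_mod_ring (e11 x), to_int_mod_ring (e12 x),
     to_int_mod_ring (e21 x), to_int_mod_ring (e22 x))"

lemma inj_to_tuple: "inj to_tuple"
  by (rule injI) (auto simp: to_tuple_def m2_eq_iff)

lemma to_tuple_mult:
  "to_tuple (x * y :: 'a::prime_card mod_ring m2) =
     mult2 (residue_ring (int CARD('a))) (to_tuple x) (to_tuple y)"
  by (simp add: to_tuple_def times_m2_def mult2_def residue_ring_def to_int_add to_int_mult)

lemma range_to_tuple:
  assumes "x \<in> carrier (residue_ring (int CARD('a)))" "y \<in> carrier (residue_ring (int CARD('a)))"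
    "z \<in> carrier (residue_ring (int CARD('a)))" "w \<in> carrier (residue_ring (int CARD('a)))"
  shows "\<exists>v :: 'a::prime_card mod_ring m2. (x, y, z, w) = to_tuple v"
  using assms
  by (intro exI[of _ "M2 (of_int_mod_ring x) (of_int_mod_ring y) (of_int_mod_ring z) (of_int_mod_ring w)"])
    (auto simp: to_tuple_def residue_ring_def)

lemma det2_to_tuple:
  "det2 (residue_ring (int CARD('a))) (to_tuple x) = to_int_mod_ring (det (x :: 'a::prime_card mod_ring m2))"
proof -
  interpret residues "int CARD('a)" "residue_ring (int CARD('a))"
    using prime_gt_1_int[OF prime_card_int] by unfold_locales simp_all
  show ?thesis
    by (simp add: to_tuple_def det2_def det_def a_minus_def res_add_eq res_mult_eq res_neg_eq
        to_int_diff to_int_mult mod_simps)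
qed

lemma to_tuple_carrier:
  "to_tuple ` {x :: 'a::prime_card mod_ring m2. det x = 1} = carrier (SL2 (residue_ring (int CARD('a))))"
proof -
  have one: "to_int_mod_ring y = 1 \<longleftrightarrow> y = 1" for y :: "'a mod_ring"
    by (metis of_int_mod_ring_to_int_mod_ring to_int_mod_ring_hom.hom_one)
  have carr: "to_int_mod_ring y \<in> carrier (residue_ring (int CARD('a)))" for y :: "'a mod_ring"
    using to_int_bounds[of y] by (simp add: residue_ring_def)
  show ?thesis
  proof (intro subset_antisym subsetI)
    fix A assume "A \<in> to_tuple ` {x :: 'a mod_ring m2. det x = 1}"
    then obtain x :: "'a mod_ring m2" where x: "A = to_tuple x" "det x = 1"
      by blast
    have "A \<in> carrier (residue_ring (int CARD('a))) \<times> carrier (residue_ring (int CARD('a))) \<times>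
        carrier (residue_ring (int CARD('a))) \<times> carrier (residue_ring (int CARD('a)))"
      unfolding x(1) to_tuple_def using carr by blast
    moreover have "det2 (residue_ring (int CARD('a))) A = \<one>\<^bsub>residue_ring (int CARD('a))\<^esub>"
      unfolding x(1) det2_to_tuple x(2) by (simp add: residue_ring_def)
    ultimately show "A \<in> carrier (SL2 (residue_ring (int CARD('a))))"
      by (simp add: SL2_def)
  next
    fix A assume A: "A \<in> carrier (SL2 (residue_ring (int CARD('a))))"
    obtain x y z w where "A = (x, y, z, w)"
      by (cases A)
    then obtain v :: "'a mod_ring m2" where v: "A = to_tuple v"
      using A range_to_tuple[where 'a = 'a, of x y z w] by (auto simp: SL2_def)
    have "to_int_mod_ring (det v) = 1"
      using A unfolding v SL2_def by (simp add: det2_to_tuple) (simp add: residue_ring_def)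
    then show "A \<in> to_tuple ` {x :: 'a mod_ring m2. det x = 1}"
      using v by (simp add: one)
  qed
qed

section \<open>The projection onto PSL(2, p)\<close>

definition projection :: "'a::prime_card mod_ring m2 \<Rightarrow> int mat2 set" where
  "projection x = center (SL2 (residue_ring (int CARD('a)))) #>\<^bsub>SL2 (residue_ring (int CARD('a)))\<^esub> to_tuple x"

context
  fixes R :: "int ring" and G :: "int mat2 monoid"
  assumes R: "R = residue_ring (int CARD('a::prime_card))" and G: "G = SL2 R"
begin

interpretation cring R
proof -
  interpret residues "int CARD('a)" R
    unfolding R using prime_gt_1_int[OF prime_card_int] by unfold_locales simp_all
  show "cring R" by unfold_locales
qed

interpretation G: group G
  unfolding G by (rule group_SL2)

interpretation normal "center G" G
  by (rule G.center_normal)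

lemma group_hom_projection:
  "group_hom (SL_group :: 'a mod_ring m2 monoid) (PSL2 R) projection"
proof -
  have "to_tuple \<in> hom (SL_group :: 'a mod_ring m2 monoid) G"
    using to_tuple_carrier[where 'a = 'a]
    by (auto simp: hom_def SL_group_def to_tuple_mult G R) (auto simp: SL2_def)
  from hom_compose[OF this r_coset_hom_Mod]
  have "projection \<in> hom (SL_group :: 'a mod_ring m2 monoid) (PSL2 R)"
    by (simp add: projection_def[abs_def] PSL2_def o_def G R)
  then show ?thesis
    using group_SL_group group_PSL2 by (intro group_hom.intro group_hom_axioms.intro)
qed

lemma projection_surj: "projection ` {x :: 'a mod_ring m2. det x = 1} = carrier (PSL2 R)"
proof -
  have "carrier (PSL2 R) = (\<lambda>A. center G #>\<^bsub>G\<^esub> A) ` carrier G"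
    by (auto simp: PSL2_def FactGroup_def RCOSETS_def G)
  also have "carrier G = to_tuple ` {x :: 'a mod_ring m2. det x = 1}"
    by (simp add: G R to_tuple_carrier)
  finally show ?thesis
    by (simp add: image_image projection_def G R)
qed

lemma projection_kernel:
  assumes x: "det x = 1" "projection (x :: 'a mod_ring m2) = \<one>\<^bsub>PSL2 R\<^esub>"
  shows "x = 1 \<or> x = - 1"
proof -
  have carr: "to_tuple y \<in> carrier G" if "det y = 1" for y :: "'a mod_ring m2"
    using that to_tuple_carrier[where 'a = 'a] by (auto simp: G R)
  have "center G #>\<^bsub>G\<^esub> to_tuple x = center G"
    using x(2) by (simp add: projection_def PSL2_def FactGroup_def G R)
  then have center: "to_tuple x \<in> center G"
    by (rule G.coset_join1[OF _ carr[OF x(1)] subgroup_axioms])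
  have comm: "x * y = y * x" if "det y = 1" for y
  proof -
    have "to_tuple x \<otimes>\<^bsub>G\<^esub> to_tuple y = to_tuple y \<otimes>\<^bsub>G\<^esub> to_tuple x"
      using center carr[OF that] unfolding center_def by blast
    then have "to_tuple (x * y) = to_tuple (y * x)"
      by (simp add: G R to_tuple_mult SL2_def)
    then show ?thesis
      using inj_to_tuple by (auto dest: injD)
  qed
  \<comment> \<open>Commuting with both elementary matrices forces a scalar matrix.\<close>
  have "x * M2 1 1 0 1 = M2 1 1 0 1 * x" "x * M2 1 0 1 1 = M2 1 0 1 1 * x"
    by (intro comm, simp add: det_def)+
  then have "x = scal (e11 x)"
    by (auto simp: times_m2_def scal_def m2_eq_iff)
  moreover from this have "e11 x ^ 2 = 1"
    using x(1) by (metis det_scal)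
  then have "e11 x = 1 \<or> e11 x = - 1"
    by (simp add: power2_eq_1_iff)
  ultimately show ?thesis
    by (metis scal_minus scal_one)
qed

end

lemma numeral_nonzero:
  assumes "numeral n < CARD('a::prime_card)"
  shows "(numeral n :: 'a mod_ring) \<noteq> 0"
proof
  assume "(numeral n :: 'a mod_ring) = 0"
  then have "CARD('a) dvd numeral n"
    by (intro of_nat_0_mod_ring_dvd) simp
  then show False
    using assms by (metis dvd_imp_le not_le zero_less_numeral)
qed

lemma mod_ring_of_nat: "\<exists>n. (t :: 'a::prime_card mod_ring) = of_nat n"
proof -
  have "t = of_int (to_int_mod_ring t)"
    by (simp add: of_int_of_int_mod_ring)
  also have "\<dots> = of_nat (nat (to_int_mod_ring t))"
    using to_int_bounds[of t] by simp
  finally show ?thesis ..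
qed

text \<open>For a primitive root \<open>g\<close> and \<open>p - 1 = 8 * k\<close>, the power
  \<open>g ^ k\<close> has order eight, so its fourth power is a square root of 1 other than
  1.\<close>

lemma primitive_eighth_root:
  assumes "[CARD('a::prime_card) = 1] (mod 8)"
  obtains z :: "'a::prime_card mod_ring" where "z ^ 4 = - 1"
proof -
  define p where "p = CARD('a)"
  have p: "prime p" "[p = 1] (mod 8)"
    using prime_card assms by (simp_all add: p_def)
  have "8 dvd p - 1"
    using p(2) by (rule cong_to_1_nat)
  then obtain k where k: "p - 1 = 8 * k"
    by blast
  have "k > 0"
    using k prime_gt_1_nat[OF p(1)] by (cases k) auto
  obtain g where g: "residue_primroot p g"
    using prime_primitive_root_exists p prime_gt_1_nat by blast
  then have ord: "ord p g = 8 * k" "coprime p g"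
    using p k by (simp_all add: residue_primroot_def totient_prime)
  define z :: "'a mod_ring" where "z = of_nat (g ^ k)"
  have of_nat_eq: "of_nat a = (of_nat b :: 'a mod_ring) \<longleftrightarrow> [a = b] (mod p)" for a b
    by (simp add: of_nat_eq_iff_cong_CHAR p_def)
  have z_pow: "z ^ m = 1 \<longleftrightarrow> 8 * k dvd k * m" for m
  proof -
    have "z ^ m = 1 \<longleftrightarrow> of_nat (g ^ (k * m)) = (of_nat 1 :: 'a mod_ring)"
      by (simp add: z_def power_mult)
    then show ?thesis
      by (simp only: of_nat_eq ord_divides ord(1))
  qed
  have "z ^ 8 = 1" "z ^ 4 \<noteq> 1"
    using z_pow[of 8] z_pow[of 4] \<open>k > 0\<close> by (auto dest: dvd_imp_le)
  then have "(z ^ 4) ^ 2 = 1"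
    by (simp flip: power_mult)
  then have "z ^ 4 = - 1"
    unfolding power2_eq_1_iff using \<open>z ^ 4 \<noteq> 1\<close> by blast
  then show thesis ..
qed

lemma PSL2_replacement_fails:
  assumes p: "[CARD('a::prime_card) = 1] (mod 8)"
    and max: "max_irredundant_length (PSL2 (residue_ring (int CARD('a)))) = 3"
  shows "\<not> replacement_property (PSL2 (residue_ring (int CARD('a))))"
proof -
  have prime: "prime CARD('a)"
    by (rule prime_card)
  \<comment> \<open>Nine is the only number from 2 to 11 that is 1 modulo 8.\<close>
  have "CARD('a) \<noteq> 9"
  proof
    assume "CARD('a) = 9"
    then have "prime (3 * 3 :: nat)"
      using prime by simp
    then show False
      using prime_product[of "3 :: nat" 3] by simp
  qed
  moreover have "CARD('a) mod 8 = 1" "CARD('a) > 1"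
    using p prime prime_gt_1_nat by (simp_all add: cong_def)
  ultimately have large: "CARD('a) > 11"
    by presburger
  obtain z :: "'a mod_ring" where z: "z ^ 4 = - 1"
    using primitive_eighth_root[OF p] .
  \<comment> \<open>For an eighth root of unity with \<open>z ^ 4 = - 1\<close>, the square root of
    2 is \<open>z\<close> plus its inverse, and that inverse is \<open>- (z ^ 3)\<close>.\<close>
  interpret octahedral "z ^ 2" "z - z ^ 3"
  proof
    have "z ^ 2 * z ^ 2 = z ^ 4"
      by (simp flip: power_add)
    then show "z ^ 2 * z ^ 2 = - 1"
      by (simp add: z)
    have "(z - z ^ 3) * (z - z ^ 3) = z ^ 2 - 2 * z ^ 4 + z ^ 2 * z ^ 4"
      by (simp add: algebra_simps power2_eq_square eval_nat_numeral)
    then show "(z - z ^ 3) * (z - z ^ 3) = 2"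
      by (simp add: z)
    show "(2 :: 'a mod_ring) \<noteq> 0" "(3 :: 'a mod_ring) \<noteq> 0" "(5 :: 'a mod_ring) \<noteq> 0"
      "(7 :: 'a mod_ring) \<noteq> 0" "(11 :: 'a mod_ring) \<noteq> 0"
      by (rule numeral_nonzero, use large in simp)+
    show "6 < CARD('a mod_ring)"
      using large by simp
  qed (rule mod_ring_of_nat)
  show ?thesis
    by (rule replacement_property_fails[OF group_hom_projection projection_surj])
      (use max projection_kernel in \<open>blast+\<close>)
qed

text \<open>HOL types cannot depend on the prime \<open>p\<close>, so that \<open>p\<close> elements cannot be turned into a type
  inside a proof. Instead a type is fixed whose cardinality would be a counterexample, if there
  was one.\<close>

definition counterexample :: "nat \<Rightarrow> bool" where
  "counterexample p \<longleftrightarrow> prime p \<and> [p = 1] (mod 8) \<and>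
     max_irredundant_length (PSL2 (residue_ring (int p))) = 3 \<and>
     replacement_property (PSL2 (residue_ring (int p)))"

text \<open>The default 17 keeps the value prime in every case, as the class
  \<open>prime_card\<close> demands.\<close>

definition critical_prime :: nat where
  "critical_prime = (if \<exists>p. counterexample p then SOME p. counterexample p else 17)"

lemma counterexample_critical_prime:
  "counterexample p \<Longrightarrow> counterexample critical_prime"
  unfolding critical_prime_def using someI[of counterexample p] by auto

lemma prime_critical_prime: "prime critical_prime"
proof (cases "\<exists>p. counterexample p")
  case True
  then show ?thesis
    using counterexample_critical_prime by (auto simp: counterexample_def)
next
  case False
  have "prime (17::nat)"
    by simp
  with False show ?thesis
    by (simp add: critical_prime_def)
qed

typedef critical_index = "{..<critical_prime}"
  using prime_gt_0_nat[OF prime_critical_prime] by blast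

lemma CARD_critical_index: "CARD(critical_index) = critical_prime"
  using type_definition.card[OF type_definition_critical_index] by simp

instance critical_index :: prime_card
  by standard (simp add: CARD_critical_index prime_critical_prime)

theorem theorem18:
  fixes p :: nat
  assumes "prime p" and "[p = 1] (mod 8)"
    and "max_irredundant_length (PSL2 (residue_ring (int p))) = 3"
  shows "\<not> replacement_property (PSL2 (residue_ring (int p)))"
proof
  assume "replacement_property (PSL2 (residue_ring (int p)))"
  then have "counterexample critical_prime"
    using assms by (intro counterexample_critical_prime[of p]) (simp add: counterexample_def)
  then show False
    using PSL2_replacement_fails[where 'a = critical_index]
    by (simp add: counterexample_def CARD_critical_index)
qed

end
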